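(* Let $f_1,\dots,f_n:\mathcal{H}\to(-\infty,+\infty]$ be convex, closed and proper functions such that, for $i\in\mathcal{I}_F$, $f_i$ is Fréchet differentiable everywhere with $L_i$-Lipschitz continuous gradient. Let $T_i=\partial f_i$ ($i=1,\dots,n$), assume the extended solution set $\mathcal{S}$ is nonempty, and let $F^*=\min_{z\in\mathcal{H}}\sum_{i=1}^n f_i(z)$. Consider the sequences generated by the projective splitting algorithm described in the context (including the error and stepsize conditions stated there). For $1\le k<\bar K$ and $i=1,\dots,n$ let $$\bar x_i^k=\frac{\sum_{t=1}^k\alpha_t x_i^t}{\sum_{t=1}^k\alpha_t}.$$ Fix any $p^*\in\mathcal{S}$. Then: 1. If $\bar K<\infty$, then for all $j=1,\dots,n$, $\ \sum_{i=1}^n f_i(x_j^{\bar K})=\sum_{i=1}^n f_i(z^{\bar K+1})=F^*$. 2. For all $1\le k<\bar K$, $$\sum_{i=1}^n f_i(\bar x_i^k)-F^*\le\frac{E_2\|p^1-p^*\|^2+E_3\|p^1-p^*\|}{k},$$ where $$E_2=\frac{\xi_1}{2\underline\beta\xi_2}\left(1+(3+2E_1)\tau+\overline\rho_n\tau\Big(2+\gamma E_1+\frac{\gamma\delta\xi_1}{\underline\beta^2\xi_2^2}\Big)\right),\qquad E_3=2\sqrt n\,\|p^*\|\frac{\xi_1}{\underline\beta\xi_2}.$$ Furthermore, for all $i,l=1,\dots,n$, $$\|\bar x_i^k-\bar x_l^k\|\le\frac{4\|p^1-p^*\|}{\underline\alpha k}=\frac{4\xi_1\|p^1-p^*\|}{\underline\beta\xi_2k}.$$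 3. Suppose additionally that, if $|\mathcal{I}_B|>1$, there is a set $\mathcal{I}_{\rm Lip}\subseteq\mathcal{I}_B$ with $|\mathcal{I}_{\rm Lip}|= |\mathcal{I}_B|-1$ such that for every $i\in\mathcal{I}_{\rm Lip}$ the function $f_i$ is $M_i$-Lipschitz continuous on the ball $\{x:\|x\|\le B_x\}$ (in particular, finite there). If $|\mathcal{I}_B|=1$, let $j$ be the unique element of $\mathcal{I}_B$; if $|\mathcal{I}_B|>1$, let $j$ be the unique element of $\mathcal{I}_B\setminus\mathcal{I}_{\rm Lip}$; if $|\mathcal{I}_B|=0$, let $j$ be any index in $\mathcal{I}_F$. Then, for all $1\le k<\bar K$, $$\sum_{i=1}^n f_i(\bar x_j^k)-F^*\le\frac{E_2\|p^1-p^*\|^2+E_4\|p^1-p^*\|}{k},$$ where $$E_4=E_3+\frac{4\xi_1}{\underline\beta\xi_2}\left(\sum_{i\in\mathcal{I}_{\rm Lip}}M_i+n\big(B_y+2\bar LB_x\big)\right)$$ (with $\mathcal{I}_{\rm Lip}=\emptyset$ when $|\mathcal{I}_B|\le1$).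
   Context: **General notation.** $\mathcal{H}$ is a real Hilbert space with inner product $\langle\cdot,\cdot\rangle$ and norm $\|\cdot\|$; $n\ge1$ is an integer; sums over empty index sets are $0$. The set $\{1,\dots,n\}$ is the disjoint union of $\mathcal{I}_F$ and $\mathcal{I}_B$. Here $T_i=\partial f_i$ is the convex subdifferential (so $T_i=\nabla f_i$ for $i\in\mathcal{I}_F$, which is $L_i$-Lipschitz). For maximal monotone $T$ and $\rho>0$, $\mathrm{prox}_{\rho T}=(I+\rho T)^{-1}$. **Extended solution set.** $\mathcal{S}=\{(z,w_1,\dots,w_{n-1})\in\mathcal{H}^n: w_i\in T_iz\ (i=1,\dots,n-1),\ -\sum_{i=1}^{n-1}w_i\in T_nz\}$. **Norm on $\mathcal{H}^n$.** For a fixed $\gamma>0$ and $p=(z,w_1,\dots,w_{n-1})\in\mathcal{H}^n$, $\|p\|^2=\gamma\|z\|^2+\sum_{i=1}^{n-1}\|w_i\|^2$. **Algorithm (projective splitting).** Inputs: a starting point $p^1=(z^1,w_1^1,\dots,w_{n-1}^1)\in\mathcal{H}^n$; stepsizes $\rho_i^k>0$; relaxation parameters $\beta_k\in[\underline\beta,\overline\beta]$ with $0<\underline\beta\le\overline\beta<2$; errors $e_i^k\in\mathcal{H}$ for $i\in\mathcal{I}_B$. Write $w_n^k=-\sum_{i=1}^{n-1}w_i^k$ and $p^k=(z^k,w_1^k,\dots,w_{n-1}^k)$. For $k=1,2,\dots$: - for $i\in\mathcal{I}_B$: $a=z^k+\rho_i^kw_i^k+e_i^k$, $x_i^k=\mathrm{prox}_{\rho_i^kT_i}(a)$,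 $y_i^k=(\rho_i^k)^{-1}(a-x_i^k)$ (so $y_i^k\in T_ix_i^k$); - for $i\in\mathcal{I}_F$: $x_i^k=z^k-\rho_i^k(T_iz^k-w_i^k)$, $y_i^k=T_ix_i^k$; - $u_i^k=x_i^k-x_n^k$ ($i=1,\dots,n-1$), $v^k=\sum_{i=1}^ny_i^k$, $\pi_k=\sum_{i=1}^{n-1}\|u_i^k\|^2+\gamma^{-1}\|v^k\|^2$; - if $\pi_k>0$: $\alpha_k=\beta_k\varphi_k(p^k)/\pi_k$, where $\varphi_k(p^k)=\langle z^k,v^k\rangle+\sum_{i=1}^{n-1}\langle w_i^k,u_i^k\rangle-\sum_{i=1}^n\langle x_i^k,y_i^k\rangle$, and then $z^{k+1}=z^k-\gamma^{-1}\alpha_kv^k$, $w_i^{k+1}=w_i^k-\alpha_ku_i^k$ ($i=1,\dots,n-1$); - if $\pi_k=0$: terminate, returning $z^{k+1}=x_n^k$, $w_i^{k+1}=y_i^k$ ($i=1,\dots,n-1$). $\bar K$ denotes the iteration at which the algorithm terminates ($\bar K=\infty$ if it never does). **Error conditions.** For some $\sigma\in[0,1)$ and $\delta\ge0$, for all $1\le k\le\bar K$ and $i\in\mathcal{I}_B$: $\langle z^k-x_i^k,e_i^k\rangle\ge-\sigma\|z^k-x_i^k\|^2$; $\langle e_i^k,y_i^k-w_i^k\rangle\le\rho_i^k\sigma\|y_i^k-w_i^k\|^2$; $\|e_i^k\|^2\le\delta\|z^k-x_i^k\|^2$. **Stepsize conditions.** $\underline\rho:=\min_{i=1,\dots,n}\inf_{1\le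 k\le\bar K}\rho_i^k>0$; for $i\in\mathcal{I}_B$, $\overline\rho_i:=\sup_{1\le k\le\bar K}\rho_i^k<\infty$; for $i\in\mathcal{I}_F$, $\overline\rho_i:=\sup_{1\le k\le\bar K}\rho_i^k<1/L_i$. **Constants.** $\overline\rho=\max_{i\in\mathcal{I}_B}\overline\rho_i$ ($=0$ if $\mathcal{I}_B=\emptyset$), $\bar L=\max_{i\in\mathcal{I}_F}L_i$ ($=0$ if $\mathcal{I}_F=\emptyset$), and $$\tau=\underline\beta^{-1}(2-\overline\beta)^{-1},\qquad \xi_1=2n\left[1+2\gamma^{-1}\big(\bar L^2|\mathcal{I}_F|+\underline\rho^{-2}(1+\delta)\big)\right],$$ $$\xi_2=\min\left\{(1-\sigma)\overline\rho^{-1},\ \min_{j\in\mathcal{I}_F}\{\overline\rho_j^{-1}-L_j\}\right\},\qquad \underline\alpha=\underline\beta\xi_2/\xi_1,$$ $$E_1=2(1-\sigma)^{-1}\underline\rho^{-1}\big(1+\xi_2^{-1}\bar L(1+\underline\rho\bar L)\big)\frac{\xi_1}{\underline\beta^2\xi_2},$$ where the first term in the minimum defining $\xi_2$ is $+\infty$ if $\mathcal{I}_B=\emptyset$, and the second is $+\infty$ if $\mathcal{I}_F=\emptyset$. Further, $B_x,B_y\ge0$ are defined by $$B_x^2=\min_{p\in\mathcal{S}}\left\{2\Big(\frac{\xi_1}{\xi_2^2}+\gamma^{-1}\Big)\|p^1-p\|^2+2\gamma^{-1}\|p\|^2\right\},\qquad B_y^2=\min_{p\in\mathcal{S}}\left\{2(n+E_1)\|p^1-p\|^2+2n\|p\|^2\right\}.$$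 *)

theory Defs
  imports "HOL-Analysis.Analysis"
begin

section \<open>Extended-real-valued convex functions\<close>

definition ereal_epigraph :: "('a \<Rightarrow> ereal) \<Rightarrow> ('a \<times> real) set"
  where "ereal_epigraph f = {(x, r). f x \<le> ereal r}"

definition convex_closed_proper :: "('a::real_inner \<Rightarrow> ereal) \<Rightarrow> bool"
  where "convex_closed_proper f \<longleftrightarrow>
    convex (ereal_epigraph f) \<and> closed (ereal_epigraph f) \<and>
    (\<forall>x. f x \<noteq> -\<infinity>) \<and> (\<exists>x. f x \<noteq> \<infinity>)"

definition subdifferential :: "('a::real_inner \<Rightarrow> ereal) \<Rightarrow> 'a \<Rightarrow> 'a set"
  where "subdifferential f x = {g. \<forall>y. f x + ereal (inner g (y - x)) \<le> f y}"

text \<open>The values of \<open>(I + \<rho> T)\<inverse>\<close> at \<open>a\<close>, as an inverse of a set-valued operator. For \<open>T\<close> maximal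
  monotone and \<open>\<rho> > 0\<close> this is a singleton, so \<open>x \<in> prox \<rho> T a\<close> says that \<open>x\<close> is the proximal
  point.\<close>

definition prox :: "real \<Rightarrow> ('a::real_vector \<Rightarrow> 'a set) \<Rightarrow> 'a \<Rightarrow> 'a set"
  where "prox \<rho> T a = {x. a \<in> {x + \<rho> *\<^sub>R t | t. t \<in> T x}}"


section \<open>Extended solution set and norm\<close>

text \<open>A point \<open>(z, w\<^sub>1, \<dots>, w\<^bsub>n-1\<^esub>)\<close> is encoded as a pair \<open>(z, w)\<close> with \<open>w :: nat \<Rightarrow> 'a\<close>. Neither the
  solution set nor the norm depends on the values \<open>w i\<close> with \<open>i \<notin> {1..<n}\<close>. Differences of points are
  the componentwise ones.\<close>

definition extended_solutions :: "nat \<Rightarrow> (nat \<Rightarrow> 'a::real_inner \<Rightarrow> 'a set) \<Rightarrow> ('a \<times> (nat \<Rightarrow> 'a)) set"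
  where "extended_solutions n T =
    {(z, w). (\<forall>i\<in>{1..<n}. w i \<in> T i z) \<and> - (\<Sum>i\<in>{1..<n}. w i) \<in> T n z}"

definition pnorm :: "nat \<Rightarrow> real \<Rightarrow> 'a::real_inner \<times> (nat \<Rightarrow> 'a) \<Rightarrow> real"
  where "pnorm n \<gamma> p = sqrt (\<gamma> * (norm (fst p))\<^sup>2 + (\<Sum>i\<in>{1..<n}. (norm (snd p i))\<^sup>2))"


section \<open>Projective splitting\<close>

text \<open>The quantities computed within one iteration; \<open>x\<close>, \<open>y\<close>, \<open>w\<close> are the families indexed by \<open>i\<close> of
  that iteration.\<close>

definition ps_u :: "nat \<Rightarrow> (nat \<Rightarrow> 'a::real_inner) \<Rightarrow> nat \<Rightarrow> 'a"
  where "ps_u n x i = x i - x n"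

definition ps_v :: "nat \<Rightarrow> (nat \<Rightarrow> 'a::real_inner) \<Rightarrow> 'a"
  where "ps_v n y = (\<Sum>i=1..n. y i)"

definition ps_pi :: "nat \<Rightarrow> real \<Rightarrow> (nat \<Rightarrow> 'a::real_inner) \<Rightarrow> (nat \<Rightarrow> 'a) \<Rightarrow> real"
  where "ps_pi n \<gamma> x y =
    (\<Sum>i\<in>{1..<n}. (norm (ps_u n x i))\<^sup>2) + inverse \<gamma> * (norm (ps_v n y))\<^sup>2"

definition ps_phi ::
    "nat \<Rightarrow> (nat \<Rightarrow> 'a::real_inner) \<Rightarrow> (nat \<Rightarrow> 'a) \<Rightarrow> 'a \<times> (nat \<Rightarrow> 'a) \<Rightarrow> real"
  where "ps_phi n x y p =
    inner (fst p) (ps_v n y) + (\<Sum>i\<in>{1..<n}. inner (snd p i) (ps_u n x i))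
      - (\<Sum>i=1..n. inner (x i) (y i))"

definition ps_alpha ::
    "nat \<Rightarrow> real \<Rightarrow> real \<Rightarrow> 'a::real_inner \<times> (nat \<Rightarrow> 'a) \<Rightarrow> (nat \<Rightarrow> 'a) \<Rightarrow> (nat \<Rightarrow> 'a) \<Rightarrow> real"
  where "ps_alpha n \<gamma> b p x y = b * ps_phi n x y p / ps_pi n \<gamma> x y"

text \<open>From here on the iteration number is the first index: \<open>x k i\<close> is \<open>x\<^sub>i\<^sup>k\<close>. The termination
  iteration is the infimum in \<^typ>\<open>enat\<close>, hence \<open>\<infinity>\<close> if no \<open>\<pi>\<^sub>k\<close> vanishes. Values of the sequences
  beyond termination are left unconstrained, and all conditions below are restricted accordingly.\<close>

definition ps_stop :: "nat \<Rightarrow> real \<Rightarrow> (nat \<Rightarrow> nat \<Rightarrow> 'a::real_inner) \<Rightarrow> (nat \<Rightarrow> nat \<Rightarrow> 'a) \<Rightarrow> enat"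
  where "ps_stop n \<gamma> x y = (INF k\<in>{k. 1 \<le> k \<and> ps_pi n \<gamma> (x k) (y k) = 0}. enat k)"

definition ps_iters :: "enat \<Rightarrow> nat set"
  where "ps_iters K = {k. 1 \<le> k \<and> enat k \<le> K}"

text \<open>One pass through the loop body, from \<open>(z, w)\<close> to \<open>(z', w')\<close>. For \<open>i \<in> IF\<close> the single-valued
  operator \<open>T i\<close> is given by its value function \<open>g i\<close>.\<close>

definition ps_step ::
    "nat \<Rightarrow> nat set \<Rightarrow> nat set \<Rightarrow> (nat \<Rightarrow> 'a::real_inner \<Rightarrow> 'a set) \<Rightarrow> (nat \<Rightarrow> 'a \<Rightarrow> 'a) \<Rightarrow> real
      \<Rightarrow> (nat \<Rightarrow> real) \<Rightarrow> real \<Rightarrow> (nat \<Rightarrow> 'a)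
      \<Rightarrow> 'a \<Rightarrow> (nat \<Rightarrow> 'a) \<Rightarrow> (nat \<Rightarrow> 'a) \<Rightarrow> (nat \<Rightarrow> 'a) \<Rightarrow> 'a \<Rightarrow> (nat \<Rightarrow> 'a) \<Rightarrow> bool"
  where "ps_step n IF IB T g \<gamma> \<rho> b e z w x y z' w' \<longleftrightarrow>
    (\<forall>i\<in>IB. let a = z + \<rho> i *\<^sub>R w i + e i in
       x i \<in> prox (\<rho> i) (T i) a \<and> y i = inverse (\<rho> i) *\<^sub>R (a - x i)) \<and>
    (\<forall>i\<in>IF. x i = z - \<rho> i *\<^sub>R (g i z - w i) \<and> y i = g i (x i)) \<and>
    (if ps_pi n \<gamma> x y > 0
     then z' = z - (inverse \<gamma> * ps_alpha n \<gamma> b (z, w) x y) *\<^sub>R ps_v n y \<and>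
          (\<forall>i\<in>{1..<n}. w' i = w i - ps_alpha n \<gamma> b (z, w) x y *\<^sub>R ps_u n x i)
     else z' = x n \<and> (\<forall>i\<in>{1..<n}. w' i = y i))"

definition projective_splitting ::
    "nat \<Rightarrow> nat set \<Rightarrow> nat set \<Rightarrow> (nat \<Rightarrow> 'a::real_inner \<Rightarrow> 'a set) \<Rightarrow> (nat \<Rightarrow> 'a \<Rightarrow> 'a) \<Rightarrow> real
      \<Rightarrow> (nat \<Rightarrow> nat \<Rightarrow> real) \<Rightarrow> (nat \<Rightarrow> real) \<Rightarrow> (nat \<Rightarrow> nat \<Rightarrow> 'a)
      \<Rightarrow> (nat \<Rightarrow> 'a) \<Rightarrow> (nat \<Rightarrow> nat \<Rightarrow> 'a) \<Rightarrow> (nat \<Rightarrow> nat \<Rightarrow> 'a) \<Rightarrow> (nat \<Rightarrow> nat \<Rightarrow> 'a) \<Rightarrow> bool"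
  where "projective_splitting n IF IB T g \<gamma> \<rho> \<beta> e z w x y \<longleftrightarrow>
    (\<forall>k. w k n = - (\<Sum>i\<in>{1..<n}. w k i)) \<and>
    (\<forall>k\<in>ps_iters (ps_stop n \<gamma> x y).
       ps_step n IF IB T g \<gamma> (\<rho> k) (\<beta> k) (e k) (z k) (w k) (x k) (y k) (z (Suc k)) (w (Suc k)))"


section \<open>The optimal value is attained\<close>

lemma minimum_attained:
  fixes f :: "nat \<Rightarrow> 'a::real_inner \<Rightarrow> ereal"
  assumes n: "n \<ge> 1"
    and S: "(z, w) \<in> extended_solutions n (\<lambda>i. subdifferential (f i))"
  shows "(\<Sum>i=1..n. f i z) = (INF z'. \<Sum>i=1..n. f i z')"
proof (rule antisym)
  show "(INF z'. \<Sum>i=1..n. f i z') \<le> (\<Sum>i=1..n. f i z)"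
    by (rule INF_lower) simp
  define g where "g i = (if i = n then - (\<Sum>i\<in>{1..<n}. w i) else w i)" for i
  have split: "{1..n} = insert n {1..<n}"
    using n by auto
  have "(\<Sum>i\<in>{1..<n}. g i) = (\<Sum>i\<in>{1..<n}. w i)"
    by (rule sum.cong) (auto simp: g_def)
  then have g0: "(\<Sum>i=1..n. g i) = 0"
    unfolding split by (simp add: g_def)
  have sub: "f i z + ereal (inner (g i) (y - z)) \<le> f i y" if "i \<in> {1..n}" for i y
    using S that unfolding extended_solutions_def subdifferential_def g_def by auto
  show "(\<Sum>i=1..n. f i z) \<le> (INF z'. \<Sum>i=1..n. f i z')"
  proof (rule INF_greatest)
    fix y
    have "(\<Sum>i=1..n. ereal (inner (g i) (y - z))) = 0"
      using g0 by (simp add: inner_sum_left[symmetric])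
    then have "(\<Sum>i=1..n. f i z) = (\<Sum>i=1..n. f i z + ereal (inner (g i) (y - z)))"
      by (simp only: sum.distrib add_0_right)
    also have "\<dots> \<le> (\<Sum>i=1..n. f i y)"
      by (rule sum_mono) (rule sub)
    finally show "(\<Sum>i=1..n. f i z) \<le> (\<Sum>i=1..n. f i y)" .
  qed
qed

end

theory Submission
  imports Defs
begin

text \<open>
  Write \<open>D = \<parallel>p\<^sup>1 - p*\<parallel>\<close> and \<open>\<alpha>lo = \<beta>lo \<xi>2 / \<xi>1\<close>. The step from \<open>p\<^sup>k\<close> to \<open>p\<^sup>k\<^sup>+\<^sup>1\<close> is a relaxed projection for the affine
  function \<open>\<phi>\<^sub>k\<close>, so \<open>\<parallel>p\<^sup>k\<^sup>+\<^sup>1 - r\<parallel>\<^sup>2 \<le> \<parallel>p\<^sup>k - r\<parallel>\<^sup>2 + 2 \<alpha>\<^sub>k \<phi>\<^sub>k(r)\<close> for every point \<open>r\<close>, and \<open>\<alpha>\<^sub>k \<ge> \<alpha>lo\<close>. Solutions have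
  \<open>\<phi>\<^sub>k(p*) \<le> 0\<close>, which gives Fejer monotonicity. For \<open>r = (z*, 0)\<close> the subgradient inequality gives
  \<open>\<Sum>\<^sub>i f\<^sub>i(x\<^sub>i\<^sup>k) - F* \<le> -\<phi>\<^sub>k(r)\<close>; summing up, convexity gives a bound by
  \<open>(D\<^sup>2 / 2 + 2 D \<parallel>p*\<parallel>) / (\<alpha>lo k)\<close>, which needs neither \<open>E1\<close> nor the additional terms of \<open>E2\<close>. The differences of the averages
  telescope as well, since \<open>\<alpha>\<^sub>k (x\<^sub>i\<^sup>k - x\<^sub>n\<^sup>k) = w\<^sub>i\<^sup>k - w\<^sub>i\<^sup>k\<^sup>+\<^sup>1\<close>. A common argument \<open>x\<^sub>j\<close> then costs a Lipschitz
  constant per block times such a difference; the constants come from \<open>\<parallel>x\<^sub>i\<^sup>k\<parallel> \<le> Bx\<close> and \<open>\<parallel>y\<^sub>i\<^sup>k\<parallel> \<le> By\<close>.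
\<close>

section \<open>Subgradients\<close>

lemma subgradient_finite:
  assumes "convex_closed_proper f" "s \<in> subdifferential f x"
  shows "\<bar>f x\<bar> \<noteq> \<infinity>"
proof -
  obtain u where u: "f u \<noteq> \<infinity>" using assms(1) by (auto simp: convex_closed_proper_def)
  have "f x + ereal (inner s (u - x)) \<le> f u" using assms(2) by (auto simp: subdifferential_def)
  then have "f x \<noteq> \<infinity>" using u by auto
  moreover have "f x \<noteq> -\<infinity>" using assms(1) by (auto simp: convex_closed_proper_def)
  ultimately show ?thesis by auto
qed

lemma subgradient_ineq:
  assumes "s \<in> subdifferential f x" "\<bar>f x\<bar> \<noteq> \<infinity>" "\<bar>f u\<bar> \<noteq> \<infinity>"
  shows "real_of_ereal (f x) + inner s (u - x) \<le> real_of_ereal (f u)"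
proof -
  have "f x + ereal (inner s (u - x)) \<le> f u" using assms(1) by (auto simp: subdifferential_def)
  then show ?thesis using assms(2,3) by (cases "f x"; cases "f u") auto
qed

lemma subdifferential_monotone:
  assumes "convex_closed_proper f" "s \<in> subdifferential f x" "t \<in> subdifferential f u"
  shows "0 \<le> inner (x - u) (s - t)"
proof -
  have fin: "\<bar>f x\<bar> \<noteq> \<infinity>" "\<bar>f u\<bar> \<noteq> \<infinity>" using subgradient_finite[OF assms(1,2)] subgradient_finite[OF assms(1,3)] by blast+
  have "real_of_ereal (f x) + inner s (u - x) \<le> real_of_ereal (f u)"
    "real_of_ereal (f u) + inner t (x - u) \<le> real_of_ereal (f x)"
    using subgradient_ineq[OF assms(2) fin] subgradient_ineq[OF assms(3) fin(2,1)] by blast+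
  then show ?thesis by (simp add: inner_diff inner_commute)
qed

text \<open>The points \<open>(u t, f (u t))\<close> lie in the epigraph, hence so does their convex
  combination, whose second component is the bound.\<close>

lemma convex_closed_proper_Jensen:
  assumes f: "convex_closed_proper f" and A: "finite A" "\<And>t. t \<in> A \<Longrightarrow> 0 \<le> c t" "sum c A = 1"
    and fin: "\<And>t. t \<in> A \<Longrightarrow> \<bar>f (u t)\<bar> \<noteq> \<infinity>"
  shows "f (\<Sum>t\<in>A. c t *\<^sub>R u t) \<le> ereal (\<Sum>t\<in>A. c t * real_of_ereal (f (u t)))"
proof -
  have "(u t, real_of_ereal (f (u t))) \<in> ereal_epigraph f" if "t \<in> A" for t
    using fin[OF that] by (auto simp: ereal_epigraph_def ereal_real)
  then have "(\<Sum>t\<in>A. c t *\<^sub>R (u t, real_of_ereal (f (u t)))) \<in> ereal_epigraph f"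
    using f A by (intro convex_sum) (auto simp: convex_closed_proper_def)
  then show ?thesis by (simp add: ereal_epigraph_def sum_prod)
qed

text \<open>By convexity the difference quotient along the segment from \<open>x\<close> to
  \<open>u\<close> never exceeds its value at parameter 1; at 0 from the right it tends to the
  directional derivative.\<close>

lemma gradient_in_subdifferential:
  assumes f: "convex_closed_proper f" and fin: "\<And>u. \<bar>f u\<bar> \<noteq> \<infinity>"
    and g: "GDERIV (\<lambda>v. real_of_ereal (f v)) x :> s"
  shows "s \<in> subdifferential f x"
proof -
  have "inner s (u - x) \<le> real_of_ereal (f u) - real_of_ereal (f x)" for u
  proof -
    define h where "h t = real_of_ereal (f (x + t *\<^sub>R (u - x)))" for t
    have "((\<lambda>v. real_of_ereal (f v)) has_derivative (\<lambda>k. inner k s)) (at (x + 0 *\<^sub>R (u - x)))"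
      using g by (simp add: gderiv_def)
    then have "(h has_derivative (\<lambda>t. inner (t *\<^sub>R (u - x)) s)) (at 0)"
      unfolding h_def by (rule has_derivative_compose[rotated]) (auto intro!: derivative_eq_intros)
    then have "(h has_real_derivative inner s (u - x)) (at 0)"
      by (simp add: has_field_derivative_def inner_commute[of s] mult_commute_abs)
    then have "((\<lambda>t. (h t - h 0) / t) \<longlongrightarrow> inner s (u - x)) (at_right 0)"
      by (auto simp: has_field_derivative_iff intro: filterlim_at_split[THEN iffD1, THEN conjunct2])
    moreover have "(h t - h 0) / t \<le> h 1 - h 0" if "0 < t" "t < 1" for t
    proof -
      have "f (\<Sum>b\<in>UNIV. (if b then t else 1 - t) *\<^sub>R (if b then u else x))
          \<le> ereal (\<Sum>b\<in>UNIV. (if b then t else 1 - t) * real_of_ereal (f (if b then u else x)))"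
        using f fin that by (intro convex_closed_proper_Jensen) (auto simp: UNIV_bool)
      then have "f (x + t *\<^sub>R (u - x))
          \<le> ereal (t * real_of_ereal (f u) + (1 - t) * real_of_ereal (f x))"
        by (simp add: UNIV_bool algebra_simps)
      then have "h t \<le> t * h 1 + (1 - t) * h 0"
        using fin[of "x + t *\<^sub>R (u - x)"] unfolding h_def by (cases "f (x + t *\<^sub>R (u - x))") auto
      then show ?thesis using that by (simp add: field_simps)
    qed
    then have "\<forall>\<^sub>F t in at_right 0. (h t - h 0) / t \<le> h 1 - h 0"
      by (auto simp: eventually_at_right_field intro!: exI[of _ 1])
    ultimately have "inner s (u - x) \<le> h 1 - h 0"
      by (intro tendsto_upperbound) auto
    then show ?thesis by (simp add: h_def)
  qed
  then have "f x + ereal (inner s (u - x)) \<le> f u" for u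
    using fin[of x] fin[of u] by (cases "f x"; cases "f u") (auto simp: field_simps, metis add.commute le_diff_eq real_of_ereal.simps(1))
  then show ?thesis by (simp add: subdifferential_def)
qed

text \<open>A subgradient \<open>t\<close> makes \<open>x\<close> a global minimizer of
  \<open>f\<close> minus the linear form of \<open>t\<close>, so the derivative of that difference
  vanishes; the direction \<open>s - t\<close> then gives equality.\<close>

lemma subgradient_eq_gradient:
  assumes fin: "\<And>u. \<bar>f u\<bar> \<noteq> \<infinity>" and g: "GDERIV (\<lambda>v. real_of_ereal (f v)) x :> s"
    and t: "t \<in> subdifferential f x"
  shows "t = s"
proof -
  have "((\<lambda>v. real_of_ereal (f v) - inner t v) has_derivative (\<lambda>k. inner k s - inner t k)) (at x)"
    using g by (auto simp: gderiv_def intro!: derivative_eq_intros)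
  moreover have "real_of_ereal (f x) - inner t x \<le> real_of_ereal (f u) - inner t u" for u
    using subgradient_ineq[OF t fin fin, of u] by (simp add: inner_diff)
  ultimately have "(\<lambda>k. inner k s - inner t k) = (\<lambda>k. 0)"
    by (intro has_derivative_local_min) auto
  then have "inner (s - t) s - inner t (s - t) = 0" by (rule fun_cong)
  then have "inner (s - t) (s - t) = 0" by (simp add: inner_diff inner_commute)
  then show ?thesis by simp
qed

section \<open>Norm inequalities\<close>

text \<open>Young's inequality with a free weight, from expanding the square of
  \<open>sqrt t *\<^sub>R a - (1 / sqrt t) *\<^sub>R b\<close>. Later estimates depend on the choice
  of \<open>t\<close>.\<close>

lemma norm_add_sq_le:
  fixes a b :: "'a::real_inner"
  assumes "0 < t"
  shows "(norm (a + b))\<^sup>2 \<le> (1 + t) * (norm a)\<^sup>2 + (1 + 1 / t) * (norm b)\<^sup>2"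
proof -
  have "0 \<le> (norm (sqrt t *\<^sub>R a - (1 / sqrt t) *\<^sub>R b))\<^sup>2" by simp
  also have "\<dots> = t * (norm a)\<^sup>2 + (norm b)\<^sup>2 / t - 2 * inner a b"
    using assms by (simp add: power2_norm_eq_inner inner_diff inner_commute power2_eq_square[symmetric] power_divide)
  finally have "2 * inner a b \<le> t * (norm a)\<^sup>2 + (norm b)\<^sup>2 / t" by simp
  then show ?thesis by (simp add: power2_norm_eq_inner inner_add inner_commute algebra_simps)
qed

lemma norm_sum_sq_le:
  fixes a :: "nat \<Rightarrow> 'a::real_inner"
  assumes "finite A"
  shows "(norm (\<Sum>i\<in>A. a i))\<^sup>2 \<le> real (card A) * (\<Sum>i\<in>A. (norm (a i))\<^sup>2)"
proof -
  have "(norm (\<Sum>i\<in>A. a i))\<^sup>2 \<le> (\<Sum>i\<in>A. norm (a i) * 1)\<^sup>2"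
    by (intro power_mono) (auto intro: norm_sum)
  also have "\<dots> \<le> (\<Sum>i\<in>A. (norm (a i))\<^sup>2) * (\<Sum>i\<in>A. 1\<^sup>2)"
    by (rule Cauchy_Schwarz_ineq_sum)
  finally show ?thesis by (simp add: mult.commute)
qed

lemma sum_upto_split_last:
  fixes n :: nat and h :: "nat \<Rightarrow> 'b::comm_monoid_add"
  assumes "n \<ge> 1"
  shows "(\<Sum>i=1..n. h i) = (\<Sum>i\<in>{1..<n}. h i) + h n"
proof -
  have "{1..n} = insert n {1..<n}" using assms by auto
  then show ?thesis by (simp add: add.commute)
qed

text \<open>The constant is the largest eigenvalue of the Laplacian of a star with \<open>n\<close> vertices; the
  naive estimate gives \<open>2 * n\<close>, which would not suffice to bound the iterates by \<open>Bx\<close>.\<close>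

lemma sum_star_le:
  fixes a :: "nat \<Rightarrow> 'a::real_inner"
  assumes n: "n \<ge> 1"
  shows "(\<Sum>i\<in>{1..<n}. (norm (a i - a n))\<^sup>2) \<le> real n * (\<Sum>i=1..n. (norm (a i))\<^sup>2)"
proof (cases "n = 1")
  case False
  then have m: "0 < real n - 1" using n by simp
  \<comment> \<open>With weight \<open>n - 1\<close>, the \<open>n - 1\<close> copies of the last
    term add up to the same factor \<open>n\<close> as every other term has.\<close>
  have "(norm (a i - a n))\<^sup>2 \<le> real n * (norm (a i))\<^sup>2 + real n / (real n - 1) * (norm (a n))\<^sup>2" for i
    using norm_add_sq_le[OF m, of "a i" "- a n"] m by (simp add: field_simps)
  then have "(\<Sum>i\<in>{1..<n}. (norm (a i - a n))\<^sup>2)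
      \<le> (\<Sum>i\<in>{1..<n}. real n * (norm (a i))\<^sup>2 + real n / (real n - 1) * (norm (a n))\<^sup>2)"
    by (rule sum_mono)
  also have "\<dots> = real n * (\<Sum>i=1..n. (norm (a i))\<^sup>2)"
    using m n by (simp add: sum.distrib sum_distrib_left[symmetric] sum_upto_split_last[OF n] of_nat_diff distrib_left del: One_nat_def)
  finally show ?thesis .
qed simp

lemma norm_diff_scaleR_sq:
  fixes a b :: "'a::real_inner"
  shows "(norm (a - t *\<^sub>R b))\<^sup>2 = (norm a)\<^sup>2 - 2 * t * inner a b + t\<^sup>2 * (norm b)\<^sup>2"
  unfolding power2_norm_eq_inner
  by (simp add: inner_diff inner_commute power2_eq_square algebra_simps)

text \<open>The two displacements \<open>a\<close> (primal) and \<open>d\<close> (dual, scaled by the stepsize) of a proximal step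
  with relative errors have lengths within a factor \<open>q\<close> of each other and enclose an angle of cosine
  at least \<open>1 / q\<close>. Without errors \<open>q = 1\<close>, which forces \<open>a = d\<close>.\<close>

lemma monotone_displacement_le:
  fixes a d \<zeta> \<omega> :: "'a::real_inner"
  assumes q: "0 < q" and d: "(norm d)\<^sup>2 \<le> q * inner a d" and a: "(norm a)\<^sup>2 \<le> q * inner a d"
    and mono: "0 \<le> inner (\<zeta> - a) (\<omega> + d)"
  shows "(norm (\<omega> + d))\<^sup>2 \<le> (1 + q\<^sup>2) * (norm \<omega>)\<^sup>2 + 2 * q * (norm \<zeta> * norm (\<omega> + d))"
proof -
  define A W X where "A = norm a" and "W = norm \<omega>" and "X = norm \<zeta> * norm (\<omega> + d)"
  have nonneg: "0 \<le> A" "0 \<le> W" "0 \<le> X" by (auto simp: A_def W_def X_def)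
  have "inner a (\<omega> + d) \<le> X"
    using mono norm_cauchy_schwarz[of \<zeta> "\<omega> + d"] by (simp add: X_def inner_diff_left)
  then have ad: "inner a \<omega> + inner a d \<le> X" by (simp add: inner_add_right)
  have "- inner a \<omega> \<le> A * W"
    using norm_cauchy_schwarz[of a "- \<omega>"] by (simp add: A_def W_def)
  then have "inner a d \<le> X + A * W" using ad by simp
  then have "q * inner a d \<le> q * (X + A * W)" using q by simp
  then have A: "A\<^sup>2 \<le> q * X + q * (A * W)" using a by (simp add: A_def distrib_left)
  \<comment> \<open>The bound on \<open>norm d\<close> places \<open>d\<close> in the ball with
    centre \<open>(q / 2) *\<^sub>R a\<close> and radius \<open>q / 2 * A\<close>, which ties
    \<open>inner \<omega> d\<close> to \<open>inner a \<omega>\<close>.\<close>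
  have "(norm (d - (q / 2) *\<^sub>R a))\<^sup>2 = (norm d)\<^sup>2 - q * inner a d + (q / 2 * A)\<^sup>2"
    by (simp add: A_def norm_diff_scaleR_sq inner_commute power_mult_distrib power_divide)
  also have "\<dots> \<le> (q / 2 * A)\<^sup>2" using d by simp
  finally have "norm (d - (q / 2) *\<^sub>R a) \<le> q / 2 * A"
    using q nonneg by (auto intro: power2_le_imp_le)
  then have "norm \<omega> * norm (d - (q / 2) *\<^sub>R a) \<le> W * (q / 2 * A)"
    unfolding W_def by (intro mult_left_mono) auto
  then have "inner \<omega> (d - (q / 2) *\<^sub>R a) \<le> W * (q / 2 * A)"
    using norm_cauchy_schwarz order_trans by blast
  then have "2 * inner \<omega> d \<le> q * (A * W) + q * inner a \<omega>"
    by (simp add: inner_diff inner_commute algebra_simps)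
  moreover have "q * (inner a \<omega> + inner a d) \<le> q * X" using ad q by simp
  moreover have "(norm (\<omega> + d))\<^sup>2 = W\<^sup>2 + 2 * inner \<omega> d + (norm d)\<^sup>2"
    by (simp add: W_def power2_norm_eq_inner inner_add inner_commute)
  ultimately have Y: "(norm (\<omega> + d))\<^sup>2 \<le> W\<^sup>2 + q * (A * W) + q * X"
    using d by (simp add: distrib_left)
  \<comment> \<open>For \<open>A\<close> small against \<open>W\<close>, replace \<open>A\<close> by
    \<open>q * W\<close>; otherwise the quadratic inequality for \<open>A\<close> absorbs the
    product.\<close>
  have "q * (A * W) \<le> q\<^sup>2 * W\<^sup>2 + q * X"
  proof (cases "A \<le> q * W")
    case True
    then have "(q * W) * A \<le> (q * W) * (q * W)"
      using q nonneg by (intro mult_left_mono) auto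
    then show ?thesis using q nonneg by (simp add: power2_eq_square algebra_simps add_increasing)
  next
    case False
    then have "(A - q * W) * (q * W) \<le> (A - q * W) * A"
      by (intro mult_left_mono) auto
    then show ?thesis using A by (simp add: power2_eq_square algebra_simps)
  qed
  then show ?thesis using Y by (simp add: W_def X_def algebra_simps)
qed

text \<open>Resolves a quadratic inequality for \<open>Y\<close> by completing a square. The
  coefficient of \<open>c\<close> stays close to 1 for small \<open>t\<close>; the factor 2 comes
  from \<open>1 + t \<le> 2\<close>.\<close>

lemma square_le_weighted:
  fixes Y Z c q t :: real
  assumes t: "0 < t" "t \<le> 1" and Y: "Y\<^sup>2 \<le> c + 2 * q * (Z * Y)"
  shows "Y\<^sup>2 \<le> (1 + t) * c + 2 * (1 + 1 / t) * (q\<^sup>2 * Z\<^sup>2)"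
proof -
  have "0 \<le> (t * Y - (1 + t) * (q * Z))\<^sup>2 / t" using t by simp
  also have "\<dots> = t * Y\<^sup>2 - (1 + t) * (2 * q * (Z * Y)) + (1 + t) * (1 + 1 / t) * (q\<^sup>2 * Z\<^sup>2)"
    using t by (simp add: field_simps power2_eq_square)
  finally have 1: "(1 + t) * (2 * q * (Z * Y)) \<le> t * Y\<^sup>2 + (1 + t) * (1 + 1 / t) * (q\<^sup>2 * Z\<^sup>2)"
    by simp
  have "(1 + t) * Y\<^sup>2 \<le> (1 + t) * (c + 2 * q * (Z * Y))"
    using t Y by (intro mult_left_mono) auto
  then have "Y\<^sup>2 \<le> (1 + t) * c + (1 + t) * (1 + 1 / t) * (q\<^sup>2 * Z\<^sup>2)"
    using 1 by (simp add: distrib_left distrib_right)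
  moreover have "(1 + t) * ((1 + 1 / t) * (q\<^sup>2 * Z\<^sup>2)) \<le> 2 * ((1 + 1 / t) * (q\<^sup>2 * Z\<^sup>2))"
    using t by (intro mult_right_mono) auto
  ultimately show ?thesis by (simp only: mult.assoc)
qed

section \<open>Affine separators and the projection step\<close>

text \<open>Adds the implicit \<open>n\<close>-th multiplier, so that all blocks are treated alike
  and the multipliers sum to zero.\<close>

definition ext_mult :: "nat \<Rightarrow> 'a::real_inner \<times> (nat \<Rightarrow> 'a) \<Rightarrow> nat \<Rightarrow> 'a"
  where "ext_mult n p i = (if i = n then - (\<Sum>j\<in>{1..<n}. snd p j) else snd p i)"

lemma sum_ext_mult: "n \<ge> 1 \<Longrightarrow> (\<Sum>i=1..n. ext_mult n p i) = 0"
  by (simp add: sum_upto_split_last ext_mult_def del: One_nat_def)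

lemma ext_mult_in_subdifferential:
  assumes "p \<in> extended_solutions n T" "i \<in> {1..n}"
  shows "ext_mult n p i \<in> T i (fst p)"
  using assms by (cases "i = n") (auto simp: extended_solutions_def ext_mult_def)

text \<open>Because the completed multipliers sum to zero, the separator splits into one
  monotonicity pairing per block.\<close>

lemma ps_phi_eq:
  assumes n: "n \<ge> 1"
  shows "ps_phi n x y p = (\<Sum>i=1..n. inner (fst p - x i) (y i - ext_mult n p i))"
proof -
  have "(\<Sum>i=1..n. inner (x i) (ext_mult n p i))
      = (\<Sum>i\<in>{1..<n}. inner (x i) (snd p i)) - (\<Sum>i\<in>{1..<n}. inner (x n) (snd p i))"
    using n by (simp add: sum_upto_split_last ext_mult_def inner_sum_right del: One_nat_def)
  moreover have "(\<Sum>i=1..n. inner (fst p - x i) (y i - ext_mult n p i))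
      = inner (fst p) (ps_v n y) - inner (fst p) (\<Sum>i=1..n. ext_mult n p i)
        - (\<Sum>i=1..n. inner (x i) (y i)) + (\<Sum>i=1..n. inner (x i) (ext_mult n p i))"
    by (simp add: ps_v_def inner_diff inner_sum_right sum.distrib sum_subtractf)
  ultimately show ?thesis
    unfolding sum_ext_mult[OF n]
    by (simp add: ps_phi_def ps_u_def inner_diff sum_subtractf inner_commute)
qed

lemma pnorm_sq:
  assumes "0 < \<gamma>"
  shows "(pnorm n \<gamma> p)\<^sup>2 = \<gamma> * (norm (fst p))\<^sup>2 + (\<Sum>i\<in>{1..<n}. (norm (snd p i))\<^sup>2)"
  unfolding pnorm_def using assms by (intro real_sqrt_pow2 add_nonneg_nonneg sum_nonneg) auto

lemma pnorm_nonneg: "0 < \<gamma> \<Longrightarrow> 0 \<le> pnorm n \<gamma> p"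
  unfolding pnorm_def by (intro real_sqrt_ge_zero add_nonneg_nonneg sum_nonneg) auto

lemma ps_pi_nonneg: "0 < \<gamma> \<Longrightarrow> 0 \<le> ps_pi n \<gamma> x y"
  unfolding ps_pi_def by (intro add_nonneg_nonneg sum_nonneg) auto

text \<open>In the weighted inner product, \<open>ps_u\<close> and
  \<open>inverse \<gamma> *\<^sub>R ps_v n y\<close> form the gradient of the affine function
  \<open>ps_phi n x y\<close>, with squared norm \<open>ps_pi\<close>. The identity expands the
  squared distance after a gradient step of arbitrary length.\<close>

lemma pnorm_projection_step:
  assumes \<gamma>: "0 < \<gamma>"
    and z: "fst p' = fst p - (inverse \<gamma> * \<alpha>) *\<^sub>R ps_v n y"
    and w: "\<And>i. i \<in> {1..<n} \<Longrightarrow> snd p' i = snd p i - \<alpha> *\<^sub>R ps_u n x i"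
  shows "(pnorm n \<gamma> (p' - r))\<^sup>2
    = (pnorm n \<gamma> (p - r))\<^sup>2 - 2 * \<alpha> * (ps_phi n x y p - ps_phi n x y r) + \<alpha>\<^sup>2 * ps_pi n \<gamma> x y"
proof -
  have w': "(norm (snd p' i - snd r i))\<^sup>2
      = (norm (snd p i - snd r i))\<^sup>2 - 2 * \<alpha> * inner (snd p i - snd r i) (ps_u n x i)
        + \<alpha>\<^sup>2 * (norm (ps_u n x i))\<^sup>2" if "i \<in> {1..<n}" for i
    using norm_diff_scaleR_sq[of "snd p i - snd r i" \<alpha> "ps_u n x i"]
    by (simp add: w[OF that] diff_diff_eq add.commute)
  have z': "\<gamma> * (norm (fst p' - fst r))\<^sup>2
      = \<gamma> * (norm (fst p - fst r))\<^sup>2 - 2 * \<alpha> * inner (fst p - fst r) (ps_v n y)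
        + \<alpha>\<^sup>2 * (inverse \<gamma> * (norm (ps_v n y))\<^sup>2)"
    using norm_diff_scaleR_sq[of "fst p - fst r" "inverse \<gamma> * \<alpha>" "ps_v n y"] \<gamma>
    by (simp add: z diff_diff_eq add.commute field_simps power2_eq_square)
  have "(\<Sum>i\<in>{1..<n}. (norm (snd p' i - snd r i))\<^sup>2)
      = (\<Sum>i\<in>{1..<n}. (norm (snd p i - snd r i))\<^sup>2 - 2 * \<alpha> * inner (snd p i - snd r i) (ps_u n x i)
        + \<alpha>\<^sup>2 * (norm (ps_u n x i))\<^sup>2)"
    by (rule sum.cong[OF refl w'])
  also have "\<dots> = (\<Sum>i\<in>{1..<n}. (norm (snd p i - snd r i))\<^sup>2)
      - 2 * \<alpha> * (\<Sum>i\<in>{1..<n}. inner (snd p i - snd r i) (ps_u n x i))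
      + \<alpha>\<^sup>2 * (\<Sum>i\<in>{1..<n}. (norm (ps_u n x i))\<^sup>2)"
    by (simp add: sum.distrib sum_subtractf sum_distrib_left)
  finally show ?thesis
    using z' by (simp add: pnorm_sq[OF \<gamma>] ps_pi_def ps_phi_def inner_diff_left sum_subtractf algebra_simps)
qed

text \<open>The Cauchy-Schwarz inequality for that gradient, read off from a nonnegative squared
  distance.\<close>

lemma ps_phi_diff_sq_le:
  assumes \<gamma>: "0 < \<gamma>" and pi: "0 < ps_pi n \<gamma> x y"
  shows "(ps_phi n x y p - ps_phi n x y r)\<^sup>2 \<le> ps_pi n \<gamma> x y * (pnorm n \<gamma> (p - r))\<^sup>2"
proof -
  define D where "D = ps_phi n x y p - ps_phi n x y r"
  \<comment> \<open>The step length minimizing the quadratic in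
    \<open>pnorm_projection_step\<close>.\<close>
  define \<alpha> where "\<alpha> = D / ps_pi n \<gamma> x y"
  define p' where "p' = (fst p - (inverse \<gamma> * \<alpha>) *\<^sub>R ps_v n y, \<lambda>i. snd p i - \<alpha> *\<^sub>R ps_u n x i)"
  have "0 \<le> (pnorm n \<gamma> (p' - r))\<^sup>2" by simp
  also have "\<dots> = (pnorm n \<gamma> (p - r))\<^sup>2 - 2 * \<alpha> * D + \<alpha>\<^sup>2 * ps_pi n \<gamma> x y"
    unfolding D_def by (rule pnorm_projection_step[OF \<gamma>]) (simp_all add: p'_def)
  also have "\<dots> = (pnorm n \<gamma> (p - r))\<^sup>2 - D\<^sup>2 / ps_pi n \<gamma> x y"
    using pi by (simp add: \<alpha>_def field_simps power2_eq_square)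
  finally show ?thesis using pi by (simp add: D_def field_simps)
qed

lemma ext_mult_diff: "ext_mult n (p - r) i = ext_mult n p i - ext_mult n r i"
  by (simp add: ext_mult_def sum_subtractf)

lemma norm_ext_mult_sq_le:
  assumes "i \<in> {1..n}"
  shows "(norm (ext_mult n p i))\<^sup>2 \<le> (real n - 1) * (\<Sum>j\<in>{1..<n}. (norm (snd p j))\<^sup>2)"
proof (cases "i = n")
  case True
  then show ?thesis
    using norm_sum_sq_le[of "{1..<n}" "snd p"] assms by (simp add: ext_mult_def of_nat_diff)
next
  case False
  then have i: "i \<in> {1..<n}" and n: "1 \<le> real n - 1" using assms by auto
  have "(norm (snd p i))\<^sup>2 \<le> (\<Sum>j\<in>{1..<n}. (norm (snd p j))\<^sup>2)"
    using i by (intro member_le_sum) auto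
  also have "\<dots> \<le> (real n - 1) * \<dots>"
    using mult_right_mono[OF n, of "\<Sum>j\<in>{1..<n}. (norm (snd p j))\<^sup>2"] by (simp add: sum_nonneg)
  finally show ?thesis using False by (simp add: ext_mult_def)
qed

lemma ext_mult_zero: "ext_mult n (u, \<lambda>_. 0) i = 0"
  by (simp add: ext_mult_def)

lemma sqrt_sum_le_pnorm:
  assumes "0 < \<gamma>"
  shows "sqrt (\<Sum>i\<in>{1..<n}. (norm (snd p i))\<^sup>2) \<le> pnorm n \<gamma> p"
  unfolding pnorm_def using assms by simp

section \<open>Runs of the algorithm\<close>

text \<open>The estimates inside take an arbitrary \<open>p \<in> S\<close>, so that the same bounds
  serve the distinguished solution and the infima defining the radii \<open>Bx\<close> and
  \<open>By\<close> of the theorem.\<close>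

locale projective_splitting_run =
  fixes n :: nat and IF IB :: "nat set"
    and f :: "nat \<Rightarrow> 'a::{real_inner, complete_space} \<Rightarrow> ereal"
    and g :: "nat \<Rightarrow> 'a \<Rightarrow> 'a" and L :: "nat \<Rightarrow> real"
    and T :: "nat \<Rightarrow> 'a \<Rightarrow> 'a set" and S :: "('a \<times> (nat \<Rightarrow> 'a)) set"
    and \<gamma> :: real and \<rho> :: "nat \<Rightarrow> nat \<Rightarrow> real" and \<beta> :: "nat \<Rightarrow> real"
    and e x y w :: "nat \<Rightarrow> nat \<Rightarrow> 'a" and z :: "nat \<Rightarrow> 'a"
    and K :: enat
    and \<beta>lo \<beta>hi \<sigma> \<delta> \<rho>lo \<rho>hi Lbar \<xi>1 \<xi>2 \<alpha>lo E1 :: real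
    and \<rho>up :: "nat \<Rightarrow> real" and \<alpha> :: "nat \<Rightarrow> real"
  assumes n: "n \<ge> 1"
    and partition: "IF \<union> IB = {1..n}" "IF \<inter> IB = {}"
    and f: "\<And>i. i \<in> {1..n} \<Longrightarrow> convex_closed_proper (f i)"
    and f_finite: "\<And>i u. i \<in> IF \<Longrightarrow> \<bar>f i u\<bar> \<noteq> \<infinity>"
    and f_grad: "\<And>i u. i \<in> IF \<Longrightarrow> GDERIV (\<lambda>v. real_of_ereal (f i v)) u :> g i u"
    and f_lip: "\<And>i. i \<in> IF \<Longrightarrow> (L i)-lipschitz_on UNIV (g i)"
    and T: "\<And>i. T i = subdifferential (f i)"
    and S: "S = extended_solutions n T"
    and \<gamma>: "\<gamma> > 0"
    and run: "projective_splitting n IF IB T g \<gamma> \<rho> \<beta> e z w x y"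
    and K: "K = ps_stop n \<gamma> x y"
    and \<beta>: "0 < \<beta>lo" "\<beta>lo \<le> \<beta>hi" "\<beta>hi < 2"
      "\<And>k. k \<in> ps_iters K \<Longrightarrow> \<beta> k \<in> {\<beta>lo..\<beta>hi}"
    and \<alpha>: "\<And>k. \<alpha> k = ps_alpha n \<gamma> (\<beta> k) (z k, w k) (x k) (y k)"
    and \<sigma>: "0 \<le> \<sigma>" "\<sigma> < 1" and \<delta>: "0 \<le> \<delta>"
    and err1: "\<And>k i. k \<in> ps_iters K \<Longrightarrow> i \<in> IB \<Longrightarrow>
      inner (z k - x k i) (e k i) \<ge> - \<sigma> * (norm (z k - x k i))\<^sup>2"
    and err2: "\<And>k i. k \<in> ps_iters K \<Longrightarrow> i \<in> IB \<Longrightarrow>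
      inner (e k i) (y k i - w k i) \<le> \<rho> k i * \<sigma> * (norm (y k i - w k i))\<^sup>2"
    and err3: "\<And>k i. k \<in> ps_iters K \<Longrightarrow> i \<in> IB \<Longrightarrow>
      (norm (e k i))\<^sup>2 \<le> \<delta> * (norm (z k - x k i))\<^sup>2"
    and \<rho>_pos: "\<And>k i. k \<in> ps_iters K \<Longrightarrow> i \<in> {1..n} \<Longrightarrow> \<rho> k i > 0"
    and \<rho>lo: "\<rho>lo = Min ((\<lambda>i. INF k\<in>ps_iters K. \<rho> k i) ` {1..n})" "\<rho>lo > 0"
    and \<rho>up: "\<And>i. \<rho>up i = (SUP k\<in>ps_iters K. \<rho> k i)"
      "\<And>i. i \<in> {1..n} \<Longrightarrow> bdd_above ((\<lambda>k. \<rho> k i) ` ps_iters K)"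
      "\<And>i. i \<in> IF \<Longrightarrow> ereal (\<rho>up i) < 1 / ereal (L i)"
    and \<rho>hi: "\<rho>hi = (if IB = {} then 0 else Max (\<rho>up ` IB))"
    and Lbar: "Lbar = (if IF = {} then 0 else Max (L ` IF))"
    and \<xi>1: "\<xi>1 = 2 * real n *
      (1 + 2 * inverse \<gamma> * (Lbar\<^sup>2 * real (card IF) + inverse (\<rho>lo\<^sup>2) * (1 + \<delta>)))"
    and \<xi>2: "\<xi>2 = Min ((if IB = {} then {} else {(1 - \<sigma>) * inverse \<rho>hi})
      \<union> (\<lambda>j. inverse (\<rho>up j) - L j) ` IF)"
    and \<alpha>lo: "\<alpha>lo = \<beta>lo * \<xi>2 / \<xi>1"
    and E1: "E1 = 2 * inverse (1 - \<sigma>) * inverse \<rho>lo *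
      (1 + inverse \<xi>2 * Lbar * (1 + \<rho>lo * Lbar)) * (\<xi>1 / (\<beta>lo\<^sup>2 * \<xi>2))"
begin

section \<open>Block indices and the termination iteration\<close>

lemma index: "i \<in> IF \<Longrightarrow> i \<in> {1..n}" "i \<in> IB \<Longrightarrow> i \<in> {1..n}"
  using partition by auto

lemma forward_index: "i \<in> {1..n} \<Longrightarrow> i \<notin> IB \<Longrightarrow> i \<in> IF"
  using partition(1) by blast

lemma finite_IF: "finite IF" and finite_IB: "finite IB"
  using partition by (metis finite_Un finite_atLeastAtMost)+

text \<open>The infimum runs over indices from 1 on, so the first iteration always takes place. It
  supplies an actual stepsize, whence positivity of the suprema \<open>\<rho>up i\<close>.\<close>

lemma one_in_iters: "1 \<in> ps_iters K"
  unfolding ps_iters_def K ps_stop_def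
  by (auto intro!: INF_greatest simp: one_enat_def[symmetric])

text \<open>A finite \<open>K\<close> excludes the empty index set, whose infimum is infinite, and
  in a well-order the infimum of a nonempty set is attained.\<close>

lemma pi_at_stop:
  assumes "K = enat k"
  shows "k \<in> ps_iters K" "ps_pi n \<gamma> (x k) (y k) = 0"
proof -
  let ?A = "{k. 1 \<le> k \<and> ps_pi n \<gamma> (x k) (y k) = 0}"
  have Inf: "Inf (enat ` ?A) = enat k" using assms by (simp add: K ps_stop_def)
  have "?A \<noteq> {}"
  proof
    assume "?A = {}"
    then have "enat ` ?A = {}" by blast
    then show False using Inf by (simp only: Inf_enat_def) simp
  qed
  then have "Inf (enat ` ?A) \<in> enat ` ?A" by (auto intro: wellorder_InfI)
  then have "k \<in> ?A" unfolding Inf by auto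
  then show "k \<in> ps_iters K" "ps_pi n \<gamma> (x k) (y k) = 0" using assms by (auto simp: ps_iters_def)
qed

lemma running:
  assumes "1 \<le> k" "enat k < K"
  shows "k \<in> ps_iters K" "0 < ps_pi n \<gamma> (x k) (y k)"
proof -
  show "k \<in> ps_iters K" using assms by (simp add: ps_iters_def)
  have "ps_pi n \<gamma> (x k) (y k) \<noteq> 0"
  proof
    assume "ps_pi n \<gamma> (x k) (y k) = 0"
    then have "K \<le> enat k" using assms(1) unfolding K ps_stop_def by (intro INF_lower) simp
    then show False using assms(2) by simp
  qed
  then show "0 < ps_pi n \<gamma> (x k) (y k)" using ps_pi_nonneg[OF \<gamma>, of n "x k" "y k"] by simp
qed

lemma running_antimono:
  assumes "enat k < K" "t \<in> {1..k}"
  shows "1 \<le> t" "enat t < K"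
  using assms by (auto intro: le_less_trans[of "enat t" "enat k" K])

lemma step:
  "k \<in> ps_iters K \<Longrightarrow>
    ps_step n IF IB T g \<gamma> (\<rho> k) (\<beta> k) (e k) (z k) (w k) (x k) (y k) (z (Suc k)) (w (Suc k))"
  using run by (simp add: projective_splitting_def K)

lemma w_last: "w k n = - (\<Sum>i\<in>{1..<n}. w k i)"
  using run by (simp add: projective_splitting_def)

lemma ext_mult_w: "ext_mult n (z k, w k) i = w k i"
  by (simp add: ext_mult_def w_last)

section \<open>Stepsize bounds and the constants\<close>

lemma rho_bounds:
  assumes "k \<in> ps_iters K" "i \<in> {1..n}"
  shows "\<rho>lo \<le> \<rho> k i" "\<rho> k i \<le> \<rho>up i" "0 < \<rho> k i" "0 < \<rho>up i"
proof -
  have "bdd_below ((\<lambda>k. \<rho> k i) ` ps_iters K)"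
    using \<rho>_pos assms(2) by (intro bdd_belowI2[of _ 0]) (auto intro: less_imp_le)
  then have "(INF k\<in>ps_iters K. \<rho> k i) \<le> \<rho> k i" using assms(1) by (intro cINF_lower)
  moreover have "\<rho>lo \<le> (INF k\<in>ps_iters K. \<rho> k i)"
    unfolding \<rho>lo using assms(2) by (intro Min_le) auto
  ultimately show "\<rho>lo \<le> \<rho> k i" by simp
  show up: "\<rho> k i \<le> \<rho>up i" unfolding \<rho>up(1) using assms \<rho>up(2) by (intro cSUP_upper) auto
  show "0 < \<rho> k i" using \<rho>_pos assms by blast
  then show "0 < \<rho>up i" using up by simp
qed

lemma rho_le_hi:
  assumes "k \<in> ps_iters K" "i \<in> IB"
  shows "\<rho> k i \<le> \<rho>hi"
proof -
  have "\<rho>up i \<le> \<rho>hi" using assms finite_IB by (auto simp: \<rho>hi)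
  then show ?thesis using rho_bounds(2)[OF assms(1) index(2)[OF assms(2)]] by simp
qed

lemma L_nonneg: "i \<in> IF \<Longrightarrow> 0 \<le> L i"
  using f_lip lipschitz_on_nonneg by blast

lemma L_le_Lbar: "i \<in> IF \<Longrightarrow> L i \<le> Lbar"
  using finite_IF by (auto simp: Lbar)

lemma Lbar_nonneg: "0 \<le> Lbar"
proof (cases "IF = {}")
  case False
  then obtain i where "i \<in> IF" by auto
  then show ?thesis using L_nonneg L_le_Lbar order_trans by blast
qed (simp add: Lbar)

lemma L_less_inverse_rho:
  assumes "i \<in> IF"
  shows "L i < inverse (\<rho>up i)"
\<comment> \<open>For \<open>L i = 0\<close> the stepsize hypothesis compares with an infinite
  bound, and the claim is just positivity of \<open>\<rho>up i\<close>.\<close>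
proof (cases "L i = 0")
  case True
  then show ?thesis using rho_bounds(4)[OF one_in_iters index(1)[OF assms]] by simp
next
  case False
  then have "0 < L i" using L_nonneg[OF assms] by simp
  moreover from this have "\<rho>up i < 1 / L i"
    using \<rho>up(3)[OF assms] by (simp add: one_ereal_def)
  ultimately show ?thesis
    using rho_bounds(4)[OF one_in_iters index(1)[OF assms]] by (simp add: field_simps)
qed

lemma q_ge1: "1 \<le> inverse (1 - \<sigma>)"
  using \<sigma> by (simp add: field_simps)

text \<open>The minimum is over a finite set, nonempty because \<open>n \<ge> 1\<close> provides a
  block, and its elements are positive by \<open>\<sigma> < 1\<close> and
  \<open>L_less_inverse_rho\<close>.\<close>

lemma xi2_props:
  shows "0 < \<xi>2"
    and xi2_backward: "k \<in> ps_iters K \<Longrightarrow> i \<in> IB \<Longrightarrow> \<rho> k i * \<xi>2 \<le> 1 - \<sigma>"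
    and xi2_forward: "k \<in> ps_iters K \<Longrightarrow> i \<in> IF \<Longrightarrow> \<xi>2 \<le> inverse (\<rho> k i) - L i"
proof -
  let ?A = "(if IB = {} then {} else {(1 - \<sigma>) * inverse \<rho>hi}) \<union> (\<lambda>j. inverse (\<rho>up j) - L j) ` IF"
  have fin: "finite ?A" using finite_IF by simp
  have ne: "?A \<noteq> {}" using partition(1) n by auto
  have hi: "0 < \<rho>hi" if "i \<in> IB" for i
    using rho_le_hi[OF one_in_iters that] rho_bounds(3)[OF one_in_iters index(2)[OF that]] by simp
  have all_pos: "0 < a" if "a \<in> ?A" for a
    using that \<sigma> hi L_less_inverse_rho by (auto split: if_splits)
  then show pos: "0 < \<xi>2" unfolding \<xi>2 by (subst Min_gr_iff[OF fin ne]) (use all_pos in blast)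
  have le: "\<xi>2 \<le> a" if "a \<in> ?A" for a unfolding \<xi>2 by (rule Min_le[OF fin that])
  show "\<rho> k i * \<xi>2 \<le> 1 - \<sigma>" if "k \<in> ps_iters K" "i \<in> IB"
  proof -
    have "\<xi>2 \<le> (1 - \<sigma>) * inverse \<rho>hi" using that by (intro le) auto
    then have "\<rho>hi * \<xi>2 \<le> 1 - \<sigma>" using hi[OF that(2)] by (simp add: field_simps)
    moreover have "\<rho> k i * \<xi>2 \<le> \<rho>hi * \<xi>2" using rho_le_hi[OF that] pos by (intro mult_right_mono) auto
    ultimately show ?thesis by simp
  qed
  show "\<xi>2 \<le> inverse (\<rho> k i) - L i" if "k \<in> ps_iters K" "i \<in> IF"
  proof -
    have "\<xi>2 \<le> inverse (\<rho>up i) - L i" using that by (intro le) auto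
    moreover have "inverse (\<rho>up i) \<le> inverse (\<rho> k i)"
      using rho_bounds[OF that(1) index(1)[OF that(2)]] by (intro le_imp_inverse_le)
    ultimately show ?thesis by simp
  qed
qed

lemma rho_L_le1:
  assumes "k \<in> ps_iters K" "i \<in> IF"
  shows "\<rho> k i * L i \<le> 1" "\<rho> k i * \<xi>2 \<le> 1"
proof -
  note r = rho_bounds(3)[OF assms(1) index(1)[OF assms(2)]]
  have "\<rho> k i * (\<xi>2 + L i) \<le> 1"
    using xi2_forward[OF assms] r by (simp add: field_simps)
  moreover have "0 \<le> \<rho> k i * \<xi>2" "0 \<le> \<rho> k i * L i"
    using r xi2_props(1) L_nonneg[OF assms(2)] by simp_all
  ultimately show "\<rho> k i * L i \<le> 1" "\<rho> k i * \<xi>2 \<le> 1" by (simp_all add: distrib_left)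
qed

lemma rho_lo_xi2: "\<rho>lo * \<xi>2 \<le> 1" "IB \<noteq> {} \<Longrightarrow> \<rho>lo * \<xi>2 \<le> 1 - \<sigma>"
proof -
  have *: "\<rho>lo * \<xi>2 \<le> \<rho> 1 i * \<xi>2" if "i \<in> {1..n}" for i
    using rho_bounds(1)[OF one_in_iters that] xi2_props(1) by (intro mult_right_mono) auto
  show 2: "\<rho>lo * \<xi>2 \<le> 1 - \<sigma>" if ne: "IB \<noteq> {}"
  proof -
    obtain i where i: "i \<in> IB" using ne by auto
    then show ?thesis using *[OF index(2)[OF i]] xi2_backward[OF one_in_iters i] by simp
  qed
  show "\<rho>lo * \<xi>2 \<le> 1"
  proof (cases "IB = {}")
    case True
    then have i: "1 \<in> IF" using partition(1) n by auto
    then show ?thesis using *[OF index(1)[OF i]] rho_L_le1(2)[OF one_in_iters i] by simp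
  qed (use 2 \<sigma> in simp)
qed

text \<open>The constant relating squared dual to squared primal displacements in
  \<open>dual_displacement_le\<close>; \<open>\<xi>1\<close> is built from it.\<close>

definition G :: real
  where "G = Lbar\<^sup>2 * real (card IF) + inverse (\<rho>lo\<^sup>2) * (1 + \<delta>)"

lemma xi1_eq: "\<xi>1 = 2 * real n * (1 + 2 * inverse \<gamma> * G)"
  by (simp add: \<xi>1 G_def)

lemma G_ge: "inverse (\<rho>lo\<^sup>2) \<le> G"
proof -
  have "0 \<le> inverse (\<rho>lo\<^sup>2) * \<delta>" "0 \<le> Lbar\<^sup>2 * real (card IF)" using \<delta> by simp_all
  then show ?thesis by (simp add: G_def distrib_left)
qed

lemma G_pos: "0 < G"
  using G_ge \<rho>lo(2) by (meson inverse_positive_iff_positive less_le_trans zero_less_power)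

lemma xi1_pos: "0 < \<xi>1"
  using n \<gamma> G_pos by (auto simp: xi1_eq intro!: mult_pos_pos add_pos_pos)

lemma alpha_lo_pos: "0 < \<alpha>lo"
  using \<beta>(1) xi2_props(1) xi1_pos by (simp add: \<alpha>lo)

text \<open>The factor multiplying \<open>c\<close> is at most \<open>\<xi>1 / 2\<close>, as
  \<open>inverse (\<rho>lo\<^sup>2) \<le> G\<close>. Since \<open>\<beta>lo\<^sup>2 \<le> 4\<close>,
  the coefficient of \<open>\<xi>1\<close> in \<open>E1\<close> is at least
  \<open>1 / (2 * \<rho>lo * \<xi>2 * (1 - \<sigma>))\<close>.\<close>

lemma E1_ge:
  assumes c: "0 \<le> c" "c * (\<rho>lo * \<xi>2 * (1 - \<sigma>)) \<le> 1"
  shows "c * (real n * (1 + 2 / (\<gamma> * \<rho>lo\<^sup>2))) \<le> E1"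
proof -
  have b: "\<beta>lo\<^sup>2 \<le> 4"
    using \<beta> power_mono[of \<beta>lo 2 2] by simp
  have X: "2 * (real n * (1 + 2 / (\<gamma> * \<rho>lo\<^sup>2))) \<le> \<xi>1"
  proof -
    have "2 / (\<gamma> * \<rho>lo\<^sup>2) \<le> 2 * inverse \<gamma> * G"
      using mult_left_mono[OF G_ge, of "2 * inverse \<gamma>"] \<gamma> by (simp add: field_simps)
    then show ?thesis unfolding xi1_eq using mult_left_mono[of _ _ "2 * real n"] by fastforce
  qed
  define d where "d = \<rho>lo * \<xi>2 * (1 - \<sigma>)"
  have d: "0 < d" using \<rho>lo(2) xi2_props(1) \<sigma> by (simp add: d_def)
  have m: "1 \<le> 1 + inverse \<xi>2 * Lbar * (1 + \<rho>lo * Lbar)"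
    using Lbar_nonneg xi2_props(1) \<rho>lo(2) by simp
  have "c * (real n * (1 + 2 / (\<gamma> * \<rho>lo\<^sup>2))) \<le> c * (\<xi>1 / 2)"
    using X c(1) by (intro mult_left_mono) (simp_all only: mult.commute[of 2] le_divide_eq_numeral1)
  also have "\<dots> \<le> (1 / d) * (\<xi>1 / 2)"
    using c(2) d xi1_pos unfolding d_def[symmetric]
    by (intro mult_right_mono) (simp_all add: pos_le_divide_eq)
  also have "\<dots> \<le> (2 / d * \<xi>1) / \<beta>lo\<^sup>2"
  proof -
    have "(1 / d) * (\<xi>1 / 2) = (2 / d * \<xi>1) / 4" by simp
    also have "\<dots> \<le> (2 / d * \<xi>1) / \<beta>lo\<^sup>2"
      using b \<beta>(1) d xi1_pos by (intro divide_left_mono) auto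
    finally show ?thesis .
  qed
  also have "\<dots> = (2 / d * \<xi>1) / \<beta>lo\<^sup>2 * 1" by simp
  also have "\<dots> \<le> (2 / d * \<xi>1) / \<beta>lo\<^sup>2 * (1 + inverse \<xi>2 * Lbar * (1 + \<rho>lo * Lbar))"
    using m d xi1_pos by (intro mult_left_mono) auto
  also have "\<dots> = E1" by (simp add: E1 d_def divide_inverse mult_ac)
  finally show ?thesis .
qed

lemma E1_nonneg: "0 \<le> E1"
  using E1_ge[of 0] by simp

section \<open>Estimates within one iteration\<close>

definition gap :: "nat \<Rightarrow> nat \<Rightarrow> real"
  where "gap k i = inner (z k - x k i) (y k i - w k i)"

definition resid :: "nat \<Rightarrow> real"
  where "resid k = (\<Sum>i=1..n. (norm (z k - x k i))\<^sup>2)"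

lemma backward_update:
  assumes "k \<in> ps_iters K" "i \<in> IB"
  shows "y k i \<in> T i (x k i)" "\<rho> k i *\<^sub>R (y k i - w k i) = z k - x k i + e k i"
proof -
  have r: "0 < \<rho> k i" using rho_bounds(3)[OF assms(1) index(2)[OF assms(2)]] .
  define a where "a = z k + \<rho> k i *\<^sub>R w k i + e k i"
  have x: "x k i \<in> prox (\<rho> k i) (T i) a" and y: "y k i = inverse (\<rho> k i) *\<^sub>R (a - x k i)"
    using step[OF assms(1)] assms(2) by (auto simp: ps_step_def Let_def a_def)
  from x obtain t where t: "t \<in> T i (x k i)" "a = x k i + \<rho> k i *\<^sub>R t" by (auto simp: prox_def)
  then show "y k i \<in> T i (x k i)" using y r by simp
  show "\<rho> k i *\<^sub>R (y k i - w k i) = z k - x k i + e k i"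
    using r by (simp add: y scaleR_diff_right a_def)
qed

lemma forward_update:
  assumes "k \<in> ps_iters K" "i \<in> IF"
  shows "x k i = z k - \<rho> k i *\<^sub>R (g i (z k) - w k i)" "y k i = g i (x k i)"
  using step[OF assms(1)] assms(2) by (auto simp: ps_step_def)

lemma g_in_T:
  assumes i: "i \<in> IF"
  shows "g i u \<in> T i u"
  unfolding T by (rule gradient_in_subdifferential[OF f[OF index(1)[OF i]] f_finite[OF i] f_grad[OF i]])

lemma T_forward:
  assumes i: "i \<in> IF" and t: "t \<in> T i u"
  shows "t = g i u"
  by (rule subgradient_eq_gradient[OF f_finite[OF i] f_grad[OF i] t[unfolded T]])

lemma T_monotone:
  assumes i: "i \<in> {1..n}" and s: "s \<in> T i u" and t: "t \<in> T i v"
  shows "0 \<le> inner (u - v) (s - t)"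
  by (rule subdifferential_monotone[OF f[OF i] s[unfolded T] t[unfolded T]])

lemma y_in_T:
  assumes "k \<in> ps_iters K" "i \<in> {1..n}"
  shows "y k i \<in> T i (x k i)"
proof (cases "i \<in> IB")
  case False
  then have "i \<in> IF" using assms(2) by (simp add: forward_index)
  then show ?thesis using forward_update[OF assms(1)] g_in_T by simp
qed (use backward_update assms in blast)

lemma g_lipschitz: "i \<in> IF \<Longrightarrow> norm (g i u - g i v) \<le> L i * norm (u - v)"
  using lipschitz_onD[OF f_lip] by (auto simp: dist_norm)

text \<open>In the pairing of \<open>z k - x k i\<close> with
  \<open>\<rho> k i *\<^sub>R (y k i - w k i)\<close>, the error relation can eliminate either
  factor: eliminating the dual one leaves the term of \<open>err1\<close>, eliminating the primal
  one that of \<open>err2\<close>.\<close>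

lemma backward_gap:
  assumes k: "k \<in> ps_iters K" and i: "i \<in> IB"
  shows "(1 - \<sigma>) * (norm (z k - x k i))\<^sup>2 \<le> \<rho> k i * gap k i"
    and "(1 - \<sigma>) * (norm (\<rho> k i *\<^sub>R (y k i - w k i)))\<^sup>2 \<le> \<rho> k i * gap k i"
proof -
  note r = rho_bounds(3)[OF k index(2)[OF i]]
  have *: "\<rho> k i * gap k i = inner (z k - x k i) (\<rho> k i *\<^sub>R (y k i - w k i))"
    by (simp add: gap_def)
  also have "\<dots> = (norm (z k - x k i))\<^sup>2 + inner (z k - x k i) (e k i)"
    unfolding backward_update(2)[OF k i] by (simp add: inner_add_right power2_norm_eq_inner)
  finally show "(1 - \<sigma>) * (norm (z k - x k i))\<^sup>2 \<le> \<rho> k i * gap k i"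
    using err1[OF k i] by (simp add: algebra_simps)
  have "z k - x k i = \<rho> k i *\<^sub>R (y k i - w k i) - e k i"
    using backward_update(2)[OF k i] by (simp add: algebra_simps)
  then have "\<rho> k i * gap k i = (norm (\<rho> k i *\<^sub>R (y k i - w k i)))\<^sup>2
      - \<rho> k i * inner (e k i) (y k i - w k i)"
    unfolding * by (simp only: inner_diff_left power2_norm_eq_inner inner_scaleR_right right_diff_distrib)
  moreover have "(norm (\<rho> k i *\<^sub>R (y k i - w k i)))\<^sup>2 = \<rho> k i * (\<rho> k i * (norm (y k i - w k i))\<^sup>2)"
    by (simp add: power_mult_distrib power2_eq_square)
  then have "\<rho> k i * inner (e k i) (y k i - w k i) \<le> \<sigma> * (norm (\<rho> k i *\<^sub>R (y k i - w k i)))\<^sup>2"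
    using mult_left_mono[OF err2[OF k i], of "\<rho> k i"] r by (simp add: mult_ac)
  ultimately show "(1 - \<sigma>) * (norm (\<rho> k i *\<^sub>R (y k i - w k i)))\<^sup>2 \<le> \<rho> k i * gap k i"
    unfolding left_diff_distrib by linarith
qed

lemma forward_displacement:
  assumes k: "k \<in> ps_iters K" and i: "i \<in> IF"
  shows "y k i - w k i = (g i (x k i) - g i (z k)) + inverse (\<rho> k i) *\<^sub>R (z k - x k i)"
proof -
  have "z k - x k i = \<rho> k i *\<^sub>R (g i (z k) - w k i)" using forward_update(1)[OF k i] by simp
  then show ?thesis using forward_update(2)[OF k i] rho_bounds(3)[OF k index(1)[OF i]] by simp
qed

text \<open>For a forward block the displacement contributes \<open>inverse (\<rho> k i)\<close> and
  the change of the gradient costs at most \<open>L i\<close>; backward blocks use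
  \<open>backward_gap\<close>.\<close>

lemma gap_ge:
  assumes k: "k \<in> ps_iters K" and i: "i \<in> {1..n}"
  shows "\<xi>2 * (norm (z k - x k i))\<^sup>2 \<le> gap k i"
proof (cases "i \<in> IB")
  case True
  note r = rho_bounds(3)[OF k i]
  have "(\<rho> k i * \<xi>2) * (norm (z k - x k i))\<^sup>2 \<le> (1 - \<sigma>) * (norm (z k - x k i))\<^sup>2"
    using xi2_backward[OF k True] by (intro mult_right_mono) auto
  then have "\<rho> k i * (\<xi>2 * (norm (z k - x k i))\<^sup>2) \<le> \<rho> k i * gap k i"
    using backward_gap(1)[OF k True] by (simp add: mult.assoc)
  then show ?thesis using r by simp
next
  case False
  then have F: "i \<in> IF" using i by (simp add: forward_index)
  have "- inner (z k - x k i) (g i (x k i) - g i (z k))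
      \<le> norm (z k - x k i) * norm (g i (x k i) - g i (z k))"
    using norm_cauchy_schwarz[of "- (z k - x k i)" "g i (x k i) - g i (z k)"]
    by (simp only: inner_minus_left norm_minus_cancel)
  also have "\<dots> \<le> norm (z k - x k i) * (L i * norm (x k i - z k))"
    using g_lipschitz[OF F] by (intro mult_left_mono) auto
  also have "\<dots> = L i * (norm (z k - x k i))\<^sup>2"
    by (simp add: power2_eq_square norm_minus_commute)
  finally have "(inverse (\<rho> k i) - L i) * (norm (z k - x k i))\<^sup>2 \<le> gap k i"
    unfolding gap_def forward_displacement[OF k F]
    by (simp add: inner_add_right power2_norm_eq_inner left_diff_distrib)
  moreover have "\<xi>2 * (norm (z k - x k i))\<^sup>2 \<le> (inverse (\<rho> k i) - L i) * (norm (z k - x k i))\<^sup>2"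
    using xi2_forward[OF k F] by (intro mult_right_mono) auto
  ultimately show ?thesis by simp
qed

lemma dual_displacement_le:
  assumes k: "k \<in> ps_iters K" and i: "i \<in> {1..n}"
  shows "(norm (y k i - w k i))\<^sup>2 \<le> 2 * G * (norm (z k - x k i))\<^sup>2"
proof -
  note r = rho_bounds[OF k i]
  have inv: "inverse ((\<rho> k i)\<^sup>2) \<le> inverse (\<rho>lo\<^sup>2)"
    using r \<rho>lo(2) by (intro le_imp_inverse_le power_mono) auto
  show ?thesis
  proof (cases "i \<in> IB")
    case True
    have "(norm (z k - x k i + e k i))\<^sup>2 \<le> 2 * (norm (z k - x k i))\<^sup>2 + 2 * (norm (e k i))\<^sup>2"
      using norm_add_sq_le[of 1 "z k - x k i" "e k i"] by simp
    also have "\<dots> \<le> 2 * (1 + \<delta>) * (norm (z k - x k i))\<^sup>2"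
      using err3[OF k True] by (simp add: algebra_simps)
    finally have "(\<rho> k i)\<^sup>2 * (norm (y k i - w k i))\<^sup>2 \<le> 2 * (1 + \<delta>) * (norm (z k - x k i))\<^sup>2"
      unfolding backward_update(2)[OF k True, symmetric] by (simp add: power_mult_distrib)
    then have "(norm (y k i - w k i))\<^sup>2 \<le> inverse ((\<rho> k i)\<^sup>2) * (2 * (1 + \<delta>) * (norm (z k - x k i))\<^sup>2)"
      using r by (simp add: field_simps)
    also have "\<dots> \<le> inverse (\<rho>lo\<^sup>2) * (2 * (1 + \<delta>) * (norm (z k - x k i))\<^sup>2)"
      using inv \<delta> by (intro mult_right_mono) auto
    also have "\<dots> = 2 * (inverse (\<rho>lo\<^sup>2) * (1 + \<delta>)) * (norm (z k - x k i))\<^sup>2" by simp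
    also have "\<dots> \<le> 2 * G * (norm (z k - x k i))\<^sup>2"
      by (intro mult_right_mono) (auto simp: G_def)
    finally show ?thesis .
  next
    case False
    then have F: "i \<in> IF" using i by (simp add: forward_index)
    have "(norm (g i (x k i) - g i (z k)))\<^sup>2 \<le> (Lbar * norm (z k - x k i))\<^sup>2"
    proof (intro power_mono)
      show "norm (g i (x k i) - g i (z k)) \<le> Lbar * norm (z k - x k i)"
        using g_lipschitz[OF F, of "x k i" "z k"] mult_right_mono[OF L_le_Lbar[OF F], of "norm (z k - x k i)"]
        by (simp add: norm_minus_commute)
    qed simp
    moreover have "(norm (y k i - w k i))\<^sup>2
        \<le> 2 * (norm (g i (x k i) - g i (z k)))\<^sup>2 + 2 * (norm (inverse (\<rho> k i) *\<^sub>R (z k - x k i)))\<^sup>2"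
      unfolding forward_displacement[OF k F]
      by (rule order_trans[OF norm_add_sq_le[of 1]]) simp_all
    moreover have "(norm (inverse (\<rho> k i) *\<^sub>R (z k - x k i)))\<^sup>2
        = inverse ((\<rho> k i)\<^sup>2) * (norm (z k - x k i))\<^sup>2"
      by (simp add: power_mult_distrib power_inverse)
    ultimately have "(norm (y k i - w k i))\<^sup>2
        \<le> 2 * (Lbar\<^sup>2 + inverse ((\<rho> k i)\<^sup>2)) * (norm (z k - x k i))\<^sup>2"
      by (simp only: power_mult_distrib distrib_left distrib_right mult.assoc)
    also have "\<dots> \<le> 2 * G * (norm (z k - x k i))\<^sup>2"
    proof (intro mult_right_mono mult_left_mono)
      \<comment> \<open>The block at hand is a forward one, so the cardinality factor in
        \<open>G\<close> is at least 1.\<close>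
      have "0 < card IF" using F finite_IF by (auto simp: card_gt_0_iff)
      then have "1 \<le> real (card IF)" by simp
      then have "Lbar\<^sup>2 \<le> Lbar\<^sup>2 * real (card IF)" using mult_left_mono[of 1 "real (card IF)" "Lbar\<^sup>2"] by simp
      moreover have "inverse (\<rho>lo\<^sup>2) \<le> inverse (\<rho>lo\<^sup>2) * (1 + \<delta>)" using \<delta> by (simp add: distrib_left)
      ultimately show "Lbar\<^sup>2 + inverse ((\<rho> k i)\<^sup>2) \<le> G" using inv by (simp add: G_def)
    qed auto
    finally show ?thesis .
  qed
qed

text \<open>The multipliers add up to zero, so \<open>v\<close> is the sum of the dual
  displacements. The star estimate keeps the constant at half of \<open>\<xi>1\<close>, which
  \<open>x_dist_le\<close> relies on.\<close>

lemma pi_le: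
  assumes k: "k \<in> ps_iters K"
  shows "ps_pi n \<gamma> (x k) (y k) \<le> \<xi>1 / 2 * resid k"
proof -
  have "(\<Sum>i=1..n. w k i) = 0"
    using sum_ext_mult[OF n, of "(z k, w k)"] by (simp add: ext_mult_w)
  then have "ps_v n (y k) = (\<Sum>i=1..n. y k i - w k i)"
    by (simp add: ps_v_def sum_subtractf)
  then have "(norm (ps_v n (y k)))\<^sup>2 \<le> real n * (\<Sum>i=1..n. (norm (y k i - w k i))\<^sup>2)"
    using norm_sum_sq_le[of "{1..n}" "\<lambda>i. y k i - w k i"] by simp
  also have "\<dots> \<le> real n * (\<Sum>i=1..n. 2 * G * (norm (z k - x k i))\<^sup>2)"
    using dual_displacement_le[OF k] by (intro mult_left_mono sum_mono) auto
  also have "\<dots> = real n * (2 * G * resid k)" by (simp add: resid_def sum_distrib_left)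
  finally have "inverse \<gamma> * (norm (ps_v n (y k)))\<^sup>2 \<le> inverse \<gamma> * (real n * (2 * G * resid k))"
    using \<gamma> by (intro mult_left_mono) auto
  moreover have "(\<Sum>i\<in>{1..<n}. (norm (ps_u n (x k) i))\<^sup>2) \<le> real n * resid k"
    using sum_star_le[OF n, of "\<lambda>i. z k - x k i"]
    by (simp add: resid_def ps_u_def norm_minus_commute)
  ultimately show ?thesis by (simp add: ps_pi_def xi1_eq algebra_simps)
qed

lemma phi_eq_gap: "ps_phi n (x k) (y k) (z k, w k) = (\<Sum>i=1..n. gap k i)"
  by (simp add: ps_phi_eq[OF n] ext_mult_w gap_def)

lemma phi_ge: "k \<in> ps_iters K \<Longrightarrow> \<xi>2 * resid k \<le> ps_phi n (x k) (y k) (z k, w k)"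
  unfolding phi_eq_gap resid_def sum_distrib_left by (intro sum_mono gap_ge)

lemma resid_nonneg: "0 \<le> resid k"
  by (simp add: resid_def sum_nonneg)

lemma phi_solution_nonpos:
  assumes k: "k \<in> ps_iters K" and p: "p \<in> S"
  shows "ps_phi n (x k) (y k) p \<le> 0"
proof -
  have "inner (fst p - x k i) (y k i - ext_mult n p i) \<le> 0" if i: "i \<in> {1..n}" for i
    using T_monotone[OF i y_in_T[OF k i] ext_mult_in_subdifferential[OF p[unfolded S] i]]
    by (simp add: inner_diff)
  then show ?thesis unfolding ps_phi_eq[OF n] by (intro sum_nonpos) auto
qed

lemma alpha_ge:
  assumes "1 \<le> k" "enat k < K"
  shows "\<alpha>lo \<le> \<alpha> k"
proof -
  note k = running[OF assms]
  define \<phi> where "\<phi> = ps_phi n (x k) (y k) (z k, w k)"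
  define \<pi> where "\<pi> = ps_pi n \<gamma> (x k) (y k)"
  have "2 * (\<xi>2 * \<pi>) \<le> \<xi>2 * (\<xi>1 * resid k)"
    using mult_left_mono[OF pi_le[OF k(1)], of \<xi>2] xi2_props(1) by (simp add: \<pi>_def)
  also have "\<dots> \<le> \<xi>1 * \<phi>"
    using mult_left_mono[OF phi_ge[OF k(1)], of \<xi>1] xi1_pos by (simp add: \<phi>_def mult.left_commute)
  \<comment> \<open>There is a factor 2 to spare, dropped to match
    \<open>\<alpha>lo\<close>.\<close>
  finally have "\<xi>2 * \<pi> \<le> \<xi>1 * \<phi>" using xi2_props(1) k(2) by (simp add: \<pi>_def) (smt (verit) mult_pos_pos)
  then have "\<xi>2 / \<xi>1 \<le> \<phi> / \<pi>" using xi1_pos k(2) by (simp add: \<pi>_def field_simps)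
  then have "\<beta>lo * (\<xi>2 / \<xi>1) \<le> \<beta> k * (\<phi> / \<pi>)"
    using \<beta>(1) \<beta>(4)[OF k(1)] xi1_pos xi2_props(1) by (intro mult_mono) auto
  then show ?thesis by (simp add: \<alpha>lo \<alpha> ps_alpha_def \<phi>_def \<pi>_def)
qed

section \<open>Distances to a fixed point and Fejer monotonicity\<close>

definition dist2 :: "'a \<times> (nat \<Rightarrow> 'a) \<Rightarrow> nat \<Rightarrow> real"
  where "dist2 p k = (pnorm n \<gamma> ((z k, w k) - p))\<^sup>2"

lemma dist2_eq:
  "dist2 p k = \<gamma> * (norm (z k - fst p))\<^sup>2 + (\<Sum>i\<in>{1..<n}. (norm (w k i - snd p i))\<^sup>2)"
  by (simp add: dist2_def pnorm_sq[OF \<gamma>])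

lemma dist2_nonneg: "0 \<le> dist2 p k"
  by (simp add: dist2_def)

lemma update:
  assumes "1 \<le> k" "enat k < K"
  shows "z (Suc k) = z k - (inverse \<gamma> * \<alpha> k) *\<^sub>R ps_v n (y k)"
    "i \<in> {1..<n} \<Longrightarrow> w (Suc k) i = w k i - \<alpha> k *\<^sub>R ps_u n (x k) i"
  using step[OF running(1)[OF assms]] running(2)[OF assms] by (auto simp: ps_step_def \<alpha>)

text \<open>Every affine function value \<open>\<phi>\<^sub>k p\<close> telescopes, whether or not \<open>p\<close> is a solution; the
  rates come from \<open>p = (z, 0)\<close> with \<open>z\<close> a minimizer.\<close>

lemma dist2_step:
  assumes k: "1 \<le> k" "enat k < K"
  shows "dist2 p (Suc k) \<le> dist2 p k + 2 * \<alpha> k * ps_phi n (x k) (y k) p"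
proof -
  define \<phi> where "\<phi> = ps_phi n (x k) (y k) (z k, w k)"
  define \<pi> where "\<pi> = ps_pi n \<gamma> (x k) (y k)"
  have pi: "0 < \<pi>" using running(2)[OF k] by (simp add: \<pi>_def)
  have al: "\<alpha> k = \<beta> k * \<phi> / \<pi>" by (simp add: \<alpha> ps_alpha_def \<phi>_def \<pi>_def)
  have eq: "dist2 p (Suc k) = dist2 p k - 2 * \<alpha> k * (\<phi> - ps_phi n (x k) (y k) p) + (\<alpha> k)\<^sup>2 * \<pi>"
    unfolding dist2_def \<phi>_def \<pi>_def
    by (rule pnorm_projection_step[OF \<gamma>]) (use update[OF k] in simp_all)
  \<comment> \<open>Relaxation strictly between 0 and 2 gives this excess its sign.\<close>
  have "(\<alpha> k)\<^sup>2 * \<pi> - 2 * \<alpha> k * \<phi> = - (\<beta> k * (2 - \<beta> k) * \<phi>\<^sup>2 / \<pi>)"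
    using pi unfolding al by (simp add: field_simps power2_eq_square)
  also have "\<dots> \<le> 0"
    using \<beta>(1,3) \<beta>(4)[OF running(1)[OF k]] pi by simp
  finally show ?thesis unfolding eq by (simp add: algebra_simps)
qed

text \<open>The distance at \<open>Suc k\<close> is included because \<open>Suc k\<close> may be the
  terminating iteration; telescoping sums up to \<open>k\<close> end there.\<close>

lemma dist2_antimono:
  assumes p: "p \<in> S"
  shows "1 \<le> k \<Longrightarrow> enat k < K \<Longrightarrow> dist2 p k \<le> dist2 p 1 \<and> dist2 p (Suc k) \<le> dist2 p 1"
proof (induction k rule: nat_induct_at_least)
  have *: "dist2 p (Suc k) \<le> dist2 p k" if k: "1 \<le> k" "enat k < K" for k
  proof -
    have "\<alpha> k * ps_phi n (x k) (y k) p \<le> 0"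
      using phi_solution_nonpos[OF running(1)[OF k] p] alpha_ge[OF k] alpha_lo_pos
      by (intro mult_nonneg_nonpos) auto
    then show ?thesis using dist2_step[OF k, of p] by simp
  qed
  {
    case base
    then show ?case using *[of 1] by simp
  next
    case (Suc k)
    then have "enat k < K" by (auto intro: le_less_trans[of "enat k" "enat (Suc k)" K])
    then show ?case using Suc *[of "Suc k"] by simp
  }
qed

subsection \<open>Bounds on the iterates\<close>

lemma dist2_components:
  "\<gamma> * (norm (z k - fst p))\<^sup>2 \<le> dist2 p k"
  "(\<Sum>i\<in>{1..<n}. (norm (w k i - snd p i))\<^sup>2) \<le> dist2 p k"
  using \<gamma> unfolding dist2_eq by (auto intro: sum_nonneg)

text \<open>By \<open>phi_ge\<close>, Cauchy-Schwarz for the separator and \<open>pi_le\<close>, the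
  squared residual is bounded by a multiple of the residual itself, so one factor cancels. No
  summation over iterations is involved.\<close>

lemma resid_le:
  assumes k: "1 \<le> k" "enat k < K" and p: "p \<in> S"
  shows "resid k \<le> \<xi>1 / (2 * \<xi>2\<^sup>2) * dist2 p 1"
proof (cases "resid k = 0")
  case True
  then show ?thesis using xi1_pos dist2_nonneg by simp
next
  case False
  then have pos: "0 < resid k" using resid_nonneg[of k] by simp
  define \<phi> where "\<phi> = ps_phi n (x k) (y k) (z k, w k)"
  have "(\<xi>2 * resid k)\<^sup>2 \<le> (\<phi> - ps_phi n (x k) (y k) p)\<^sup>2"
    using phi_ge[OF running(1)[OF k]] phi_solution_nonpos[OF running(1)[OF k] p] xi2_props(1) resid_nonneg
    by (intro power_mono) (auto simp: \<phi>_def)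
  also have "\<dots> \<le> ps_pi n \<gamma> (x k) (y k) * dist2 p k"
    using ps_phi_diff_sq_le[OF \<gamma> running(2)[OF k]] by (simp add: \<phi>_def dist2_def)
  also have "\<dots> \<le> (\<xi>1 / 2 * resid k) * dist2 p 1"
    using pi_le[OF running(1)[OF k]] dist2_antimono[OF p k] running(2)[OF k] dist2_nonneg xi1_pos pos
    by (intro mult_mono) auto
  finally have "resid k * (\<xi>2\<^sup>2 * resid k) \<le> resid k * (\<xi>1 / 2 * dist2 p 1)"
    by (simp add: power_mult_distrib power2_eq_square mult_ac)
  then have "\<xi>2\<^sup>2 * resid k \<le> \<xi>1 / 2 * dist2 p 1" using pos by (simp only: mult_le_cancel_left_pos)
  then show ?thesis using xi2_props(1) by (simp add: field_simps)
qed

text \<open>The factor \<open>q\<close> of \<open>monotone_displacement_le\<close> for backward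
  blocks; the value 1 for forward blocks lets both kinds share one bound.\<close>

definition \<kappa> :: "nat \<Rightarrow> real"
  where "\<kappa> i = (if i \<in> IB then inverse (1 - \<sigma>) else 1)"

lemma kappa_ge1: "1 \<le> \<kappa> i"
  using q_ge1 by (simp add: \<kappa>_def)

lemma kappa_le: "\<kappa> i * (\<rho>lo * \<xi>2) \<le> 1"
  using rho_lo_xi2 \<sigma> by (auto simp: \<kappa>_def field_simps)

lemma kappa_E1: "(\<kappa> i)\<^sup>2 * (real n * (1 + 2 / (\<gamma> * \<rho>lo\<^sup>2))) \<le> E1"
proof (rule E1_ge)
  have "\<kappa> i * (1 - \<sigma>) \<le> 1" using \<sigma> by (simp add: \<kappa>_def)
  then have "(\<kappa> i * (\<rho>lo * \<xi>2)) * (\<kappa> i * (1 - \<sigma>)) \<le> 1 * 1"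
    using kappa_le[of i] kappa_ge1[of i] \<sigma> by (intro mult_mono) auto
  then show "(\<kappa> i)\<^sup>2 * (\<rho>lo * \<xi>2 * (1 - \<sigma>)) \<le> 1" by (simp add: power2_eq_square mult_ac)
qed simp

text \<open>From \<open>kappa_le\<close>, \<open>(\<kappa> i * \<xi>2)\<^sup>2\<close> is at most
  \<open>inverse (\<rho>lo\<^sup>2)\<close>, hence at most \<open>G\<close>, and
  \<open>\<xi>1\<close> contains the summand \<open>4 * n * G / \<gamma>\<close>.\<close>

lemma kappa_xi1: "4 * real n * (\<kappa> i)\<^sup>2 / \<gamma> \<le> \<xi>1 / \<xi>2\<^sup>2"
proof -
  have "0 \<le> \<kappa> i * (\<rho>lo * \<xi>2)" using kappa_ge1[of i] \<rho>lo(2) xi2_props(1) by simp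
  then have "(\<kappa> i * (\<rho>lo * \<xi>2))\<^sup>2 \<le> 1" using kappa_le[of i] by (simp add: power_le_one)
  then have "(\<kappa> i)\<^sup>2 * \<xi>2\<^sup>2 \<le> inverse (\<rho>lo\<^sup>2)"
    using \<rho>lo(2) by (simp add: power_mult_distrib field_simps)
  then have "(\<kappa> i)\<^sup>2 * \<xi>2\<^sup>2 \<le> G" using G_ge by simp
  then have "4 * real n / \<gamma> * ((\<kappa> i)\<^sup>2 * \<xi>2\<^sup>2) \<le> 4 * real n / \<gamma> * G"
    using \<gamma> by (intro mult_left_mono) auto
  also have "\<dots> \<le> \<xi>1" by (simp add: xi1_eq divide_inverse algebra_simps)
  finally show ?thesis using xi2_props(1) \<gamma> by (simp add: field_simps)
qed

lemma backward_kappa: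
  assumes k: "k \<in> ps_iters K" and i: "i \<in> IB"
  shows "(norm (\<rho> k i *\<^sub>R (y k i - w k i)))\<^sup>2 \<le> \<kappa> i * inner (z k - x k i) (\<rho> k i *\<^sub>R (y k i - w k i))"
    "(norm (z k - x k i))\<^sup>2 \<le> \<kappa> i * inner (z k - x k i) (\<rho> k i *\<^sub>R (y k i - w k i))"
proof -
  have *: "v \<le> \<kappa> i * s" if "(1 - \<sigma>) * v \<le> s" for v s
    using that \<sigma> i by (simp add: \<kappa>_def field_simps)
  show "(norm (\<rho> k i *\<^sub>R (y k i - w k i)))\<^sup>2 \<le> \<kappa> i * inner (z k - x k i) (\<rho> k i *\<^sub>R (y k i - w k i))"
    "(norm (z k - x k i))\<^sup>2 \<le> \<kappa> i * inner (z k - x k i) (\<rho> k i *\<^sub>R (y k i - w k i))"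
    using backward_gap[OF k i, THEN *] unfolding gap_def inner_scaleR_right by blast+
qed

lemma monotone_at_solution:
  assumes k: "k \<in> ps_iters K" and i: "i \<in> {1..n}" and p: "p \<in> S"
  shows "0 \<le> inner ((z k - fst p) - (z k - x k i))
    (\<rho> k i *\<^sub>R (w k i - ext_mult n p i) + \<rho> k i *\<^sub>R (y k i - w k i))"
proof -
  have "0 \<le> \<rho> k i * inner (x k i - fst p) (y k i - ext_mult n p i)"
    using T_monotone[OF i y_in_T[OF k i] ext_mult_in_subdifferential[OF p[unfolded S] i]]
      rho_bounds(3)[OF k i] by simp
  then show ?thesis by (simp add: scaleR_add_right[symmetric])
qed

text \<open>Since \<open>\<rho> k i * L i \<le> 1\<close>, the scaled gradient is nonexpansive, so
  the dual error is bounded by \<open>norm (x k i - fst p)\<close>. The forward step splits this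
  vector; in the square of the remainder \<open>u\<close> the cross term has a favourable sign by
  monotonicity, which leaves the factor 2.\<close>

lemma forward_dual_le:
  assumes k: "k \<in> ps_iters K" and i: "i \<in> IF" and p: "p \<in> S"
  obtains u where "norm (\<rho> k i *\<^sub>R (y k i - ext_mult n p i)) \<le> norm (\<rho> k i *\<^sub>R (w k i - ext_mult n p i) + u)"
    "(norm u)\<^sup>2 \<le> 2 * (norm (z k - fst p))\<^sup>2"
proof -
  note i' = index(1)[OF i]
  note r = rho_bounds(3)[OF k i']
  define h where "h = g i (z k) - g i (fst p)"
  have m: "ext_mult n p i = g i (fst p)"
    using T_forward[OF i ext_mult_in_subdifferential[OF p[unfolded S] i']] .
  have rL: "\<rho> k i * norm (g i u - g i v) \<le> norm (u - v)" for u v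
  proof -
    have "\<rho> k i * norm (g i u - g i v) \<le> \<rho> k i * (L i * norm (u - v))"
      using g_lipschitz[OF i] r by (intro mult_left_mono) auto
    also have "\<dots> = (\<rho> k i * L i) * norm (u - v)" by simp
    also have "\<dots> \<le> 1 * norm (u - v)"
      using rho_L_le1(1)[OF k i] by (intro mult_right_mono) auto
    finally show ?thesis by simp
  qed
  have "0 \<le> inner (z k - fst p) h"
    using T_monotone[OF i' g_in_T[OF i] g_in_T[OF i]] by (simp add: h_def)
  then have "0 \<le> \<rho> k i * inner (z k - fst p) h" using r by simp
  moreover have "(\<rho> k i * norm h)\<^sup>2 \<le> (norm (z k - fst p))\<^sup>2"
    using rL r by (intro power_mono) (auto simp: h_def)
  ultimately have u: "(norm ((z k - fst p) - \<rho> k i *\<^sub>R h))\<^sup>2 \<le> 2 * (norm (z k - fst p))\<^sup>2"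
    unfolding norm_diff_scaleR_sq by (simp add: power_mult_distrib)
  have "x k i - fst p = \<rho> k i *\<^sub>R (w k i - ext_mult n p i) + ((z k - fst p) - \<rho> k i *\<^sub>R h)"
    using forward_update(1)[OF k i] by (simp add: h_def m algebra_simps)
  moreover have "norm (\<rho> k i *\<^sub>R (y k i - ext_mult n p i)) \<le> norm (x k i - fst p)"
    using rL[of "x k i" "fst p"] r forward_update(2)[OF k i] by (simp add: m)
  ultimately show ?thesis using u by (intro that[of "(z k - fst p) - \<rho> k i *\<^sub>R h"]) (simp_all only:)
qed

text \<open>Backward blocks combine \<open>monotone_displacement_le\<close> with
  \<open>square_le_weighted\<close>; forward blocks apply Young's inequality to the splitting of
  \<open>forward_dual_le\<close>. The weight \<open>t\<close> is chosen in
  \<open>y_dist_le\<close>.\<close>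

lemma dual_block_le:
  assumes k: "k \<in> ps_iters K" and i: "i \<in> {1..n}" and p: "p \<in> S" and t: "0 < t" "t \<le> 1"
  shows "(norm (\<rho> k i *\<^sub>R (y k i - ext_mult n p i)))\<^sup>2
    \<le> (1 + t) * ((1 + (\<kappa> i)\<^sup>2) * (norm (\<rho> k i *\<^sub>R (w k i - ext_mult n p i)))\<^sup>2)
      + 2 * (1 + 1 / t) * ((\<kappa> i)\<^sup>2 * (norm (z k - fst p))\<^sup>2)"
proof (cases "i \<in> IB")
  case True
  let ?\<omega> = "\<rho> k i *\<^sub>R (w k i - ext_mult n p i)"
  have sum: "?\<omega> + \<rho> k i *\<^sub>R (y k i - w k i) = \<rho> k i *\<^sub>R (y k i - ext_mult n p i)"
    by (simp add: scaleR_add_right[symmetric])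
  have "0 < \<kappa> i" using kappa_ge1[of i] by simp
  then show ?thesis
    using monotone_displacement_le[OF _ backward_kappa[OF k True] monotone_at_solution[OF k i p]]
    unfolding sum by (intro square_le_weighted[OF t]) (simp add: mult_ac)
next
  case False
  then have F: "i \<in> IF" using i by (simp add: forward_index)
  have "1 \<le> 1 + (\<kappa> i)\<^sup>2" "1 \<le> (\<kappa> i)\<^sup>2" using kappa_ge1[of i] by simp_all
  then have "1 * (norm (\<rho> k i *\<^sub>R (w k i - ext_mult n p i)))\<^sup>2
      \<le> (1 + (\<kappa> i)\<^sup>2) * (norm (\<rho> k i *\<^sub>R (w k i - ext_mult n p i)))\<^sup>2"
    "1 * (norm (z k - fst p))\<^sup>2 \<le> (\<kappa> i)\<^sup>2 * (norm (z k - fst p))\<^sup>2"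
    by (intro mult_right_mono; simp)+
  then have "(1 + t) * (norm (\<rho> k i *\<^sub>R (w k i - ext_mult n p i)))\<^sup>2
      \<le> (1 + t) * ((1 + (\<kappa> i)\<^sup>2) * (norm (\<rho> k i *\<^sub>R (w k i - ext_mult n p i)))\<^sup>2)"
    "2 * (1 + 1 / t) * (norm (z k - fst p))\<^sup>2 \<le> 2 * (1 + 1 / t) * ((\<kappa> i)\<^sup>2 * (norm (z k - fst p))\<^sup>2)"
    using t by (intro mult_left_mono; simp)+
  moreover obtain u
    where u: "norm (\<rho> k i *\<^sub>R (y k i - ext_mult n p i)) \<le> norm (\<rho> k i *\<^sub>R (w k i - ext_mult n p i) + u)"
      "(norm u)\<^sup>2 \<le> 2 * (norm (z k - fst p))\<^sup>2"
    using forward_dual_le[OF k F p] .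
  have "(norm (\<rho> k i *\<^sub>R (y k i - ext_mult n p i)))\<^sup>2
      \<le> (1 + t) * (norm (\<rho> k i *\<^sub>R (w k i - ext_mult n p i)))\<^sup>2 + (1 + 1 / t) * (norm u)\<^sup>2"
    using u(1) norm_add_sq_le[OF t(1)] by (meson norm_ge_zero order_trans power_mono)
  moreover have "(1 + 1 / t) * (norm u)\<^sup>2 \<le> (1 + 1 / t) * (2 * (norm (z k - fst p))\<^sup>2)"
    using u(2) t by (intro mult_left_mono) auto
  ultimately show ?thesis by (simp only: mult.left_commute mult.assoc)
qed

lemma single_block_le:
  assumes k: "k \<in> ps_iters K" and n1: "n = 1" and i: "i \<in> {1..n}" and p: "p \<in> S"
  shows "(norm (z k - x k i))\<^sup>2 \<le> (\<kappa> i)\<^sup>2 * (norm (z k - fst p))\<^sup>2" (is ?primal)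
    "(norm (\<rho> k i *\<^sub>R (y k i - ext_mult n p i)))\<^sup>2 \<le> 2 * ((\<kappa> i)\<^sup>2 * (norm (z k - fst p))\<^sup>2)" (is ?dual)
proof -
  have m: "ext_mult n p i = 0" and w: "w k i = 0"
    using n1 i w_last[of k] by (simp_all add: ext_mult_def)
  have "?primal \<and> ?dual"
  proof (cases "i \<in> IB")
    case True
    define d where "d = \<rho> k i *\<^sub>R y k i"
    have "inner (z k - x k i) d \<le> inner (z k - fst p) d"
      using monotone_at_solution[OF k i p] by (simp add: m w d_def inner_diff_left right_diff_distrib)
    then have "\<kappa> i * inner (z k - x k i) d \<le> \<kappa> i * (norm (z k - fst p) * norm d)"
      using kappa_ge1[of i] norm_cauchy_schwarz[of "z k - fst p" d] by (intro mult_left_mono) auto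
    then have d: "(norm d)\<^sup>2 \<le> \<kappa> i * (norm (z k - fst p) * norm d)"
      and a: "(norm (z k - x k i))\<^sup>2 \<le> \<kappa> i * (norm (z k - fst p) * norm d)"
      using backward_kappa[OF k True] by (simp_all add: w d_def)
    have d': "norm d \<le> \<kappa> i * norm (z k - fst p)"
      using d kappa_ge1[of i] by (cases "norm d = 0") (auto simp: power2_eq_square mult.assoc[symmetric])
    have "\<kappa> i * (norm (z k - fst p) * norm d) \<le> \<kappa> i * (norm (z k - fst p) * (\<kappa> i * norm (z k - fst p)))"
      using d' kappa_ge1[of i] by (intro mult_left_mono) auto
    then have b: "\<kappa> i * (norm (z k - fst p) * norm d) \<le> (\<kappa> i)\<^sup>2 * (norm (z k - fst p))\<^sup>2"
      by (simp add: power2_eq_square mult_ac)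
    have "0 \<le> (\<kappa> i)\<^sup>2 * (norm (z k - fst p))\<^sup>2" by simp
    then show ?thesis using a d b by (simp only: m diff_zero d_def[symmetric]) linarith
  next
    case False
    then have F: "i \<in> IF" and kap: "\<kappa> i = 1" using i by (simp_all add: forward_index \<kappa>_def)
    note r = rho_bounds(3)[OF k i]
    have g0: "g i (fst p) = 0"
      using T_forward[OF F ext_mult_in_subdifferential[OF p[unfolded S] i]] m by simp
    have "norm (z k - x k i) = \<rho> k i * norm (g i (z k) - g i (fst p))"
      using forward_update(1)[OF k F] r by (simp add: w g0)
    also have "\<dots> \<le> \<rho> k i * (L i * norm (z k - fst p))"
      using g_lipschitz[OF F] r by (intro mult_left_mono) auto
    also have "\<dots> \<le> 1 * norm (z k - fst p)"
      using rho_L_le1(1)[OF k F] unfolding mult.assoc[symmetric] by (intro mult_right_mono) auto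
    finally have ?primal unfolding kap by (simp add: power_mono)
    moreover obtain u
      where u: "norm (\<rho> k i *\<^sub>R (y k i - ext_mult n p i)) \<le> norm (\<rho> k i *\<^sub>R (w k i - ext_mult n p i) + u)"
        "(norm u)\<^sup>2 \<le> 2 * (norm (z k - fst p))\<^sup>2"
      using forward_dual_le[OF k F p] .
    have "(norm (\<rho> k i *\<^sub>R (y k i - ext_mult n p i)))\<^sup>2 \<le> (norm u)\<^sup>2"
      using u(1) unfolding m w diff_self scaleR_zero_right add_0 by (rule power_mono) simp
    then have ?dual using u(2) unfolding kap power_one mult_1 by (rule order_trans)
    ultimately show ?thesis by simp
  qed
  then show ?primal ?dual by auto
qed

lemma x_dist_le:
  assumes k: "1 \<le> k" "enat k < K" and i: "i \<in> {1..n}" and p: "p \<in> S"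
  shows "(norm (x k i - fst p))\<^sup>2 \<le> (\<xi>1 / \<xi>2\<^sup>2 + inverse \<gamma>) * dist2 p 1"
proof -
  note kI = running(1)[OF k]
  define \<zeta> a where "\<zeta> = (norm (z k - fst p))\<^sup>2" and "a = (norm (z k - x k i))\<^sup>2"
  have "\<gamma> * \<zeta> \<le> dist2 p 1"
    using dist2_components(1)[of k p] dist2_antimono[OF p k] by (simp add: \<zeta>_def)
  then have \<zeta>: "\<zeta> \<le> inverse \<gamma> * dist2 p 1" using \<gamma> by (simp add: field_simps)
  \<comment> \<open>The weight 2 fits the target \<open>X + V\<close>, with \<open>X\<close> and
    \<open>V\<close> as defined below. For \<open>n \<ge> 2\<close>, \<open>3/2 * a\<close> uses
    three quarters of \<open>X\<close>; of \<open>3 * \<zeta> \<le> 3 * V\<close>, two copies of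
    \<open>V\<close> fit into the last quarter since \<open>8 * V \<le> X\<close>.\<close>
  have split: "(norm (x k i - fst p))\<^sup>2 \<le> 3 * \<zeta> + 3 / 2 * a"
    using norm_add_sq_le[of 2 "z k - fst p" "x k i - z k"] by (simp add: \<zeta>_def a_def norm_minus_commute)
  define X V where "X = \<xi>1 / \<xi>2\<^sup>2 * dist2 p 1" and "V = inverse \<gamma> * dist2 p 1"
  note c = kappa_xi1[of i]
  have k1: "1 \<le> (\<kappa> i)\<^sup>2" using kappa_ge1 by simp
  show ?thesis
  proof (cases "n = 1")
    case False
    then have "8 \<le> 4 * real n * (\<kappa> i)\<^sup>2" using n mult_mono[of 8 "4 * real n" 1 "(\<kappa> i)\<^sup>2"] k1 by simp
    then have "8 / \<gamma> \<le> 4 * real n * (\<kappa> i)\<^sup>2 / \<gamma>" using \<gamma> by (simp add: divide_right_mono)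
    then have "8 * inverse \<gamma> \<le> \<xi>1 / \<xi>2\<^sup>2" using c unfolding divide_inverse by linarith
    then have 8: "8 * (inverse \<gamma> * dist2 p 1) \<le> \<xi>1 / \<xi>2\<^sup>2 * dist2 p 1"
      using mult_right_mono[OF _ dist2_nonneg[of p 1]] by (fastforce simp: mult.assoc)
    have "a \<le> resid k" unfolding resid_def a_def using i by (intro member_le_sum) auto
    then have "a \<le> X / 2" using resid_le[OF k p] by (simp add: X_def)
    then show ?thesis
      using split \<zeta> 8 unfolding distrib_right X_def[symmetric] V_def[symmetric] by linarith
  next
    case True
    \<comment> \<open>For a single block, \<open>a\<close> and \<open>\<zeta>\<close> are both at
      most \<open>X / 4\<close>, so \<open>2 * \<zeta> + 3/2 * a\<close> stays below
      \<open>X\<close>.\<close>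
    have a: "a \<le> (\<kappa> i)\<^sup>2 * \<zeta>" using single_block_le(1)[OF kI True i p] by (simp add: a_def \<zeta>_def)
    moreover have "\<zeta> \<le> (\<kappa> i)\<^sup>2 * \<zeta>" using mult_right_mono[OF k1, of \<zeta>] by (simp add: \<zeta>_def)
    moreover have "(\<kappa> i)\<^sup>2 * \<zeta> \<le> (\<kappa> i)\<^sup>2 * (inverse \<gamma> * dist2 p 1)"
      using \<zeta> by (intro mult_left_mono) auto
    moreover have "4 * ((\<kappa> i)\<^sup>2 * (inverse \<gamma> * dist2 p 1)) \<le> \<xi>1 / \<xi>2\<^sup>2 * dist2 p 1"
      using mult_right_mono[OF c dist2_nonneg[of p 1]] True by (simp add: divide_inverse mult_ac)
    moreover have "0 \<le> a" by (simp add: a_def)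
    ultimately show ?thesis
      using split \<zeta> unfolding distrib_right X_def[symmetric] V_def[symmetric] by linarith
  qed
qed

text \<open>The block estimates are scaled by the stepsize; its square is cancelled later, so that
  only the primal part pays \<open>1 / \<rho>lo\<^sup>2\<close>. The terms with factor
  \<open>c\<close> are collected into \<open>E1\<close> by \<open>kappa_E1\<close>.\<close>

lemma y_dist_le:
  assumes k: "1 \<le> k" "enat k < K" and i: "i \<in> {1..n}" and p: "p \<in> S"
  shows "(norm (y k i - ext_mult n p i))\<^sup>2 \<le> (real n + E1) * dist2 p 1"
proof -
  note kI = running(1)[OF k]
  note r = rho_bounds(1,3)[OF kI i]
  define \<zeta> \<Omega> where "\<zeta> = (norm (z k - fst p))\<^sup>2" and "\<Omega> = (\<Sum>i\<in>{1..<n}. (norm (w k i - snd p i))\<^sup>2)"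
  have nonneg: "0 \<le> \<zeta>" "0 \<le> \<Omega>" by (auto simp: \<zeta>_def \<Omega>_def sum_nonneg)
  have D: "\<gamma> * \<zeta> + \<Omega> = dist2 p k" by (simp add: dist2_eq \<zeta>_def \<Omega>_def)
  have scale: "(norm (\<rho> k i *\<^sub>R v))\<^sup>2 = (\<rho> k i)\<^sup>2 * (norm v)\<^sup>2" for v :: 'a
    by (simp add: power_mult_distrib)
  define c where "c = (\<kappa> i)\<^sup>2 * real n"
  have c0: "0 \<le> c" by (simp add: c_def)
  have "(\<rho> k i)\<^sup>2 * (norm (y k i - ext_mult n p i))\<^sup>2 \<le> (\<rho> k i)\<^sup>2 * ((real n + c) * \<Omega>) + 2 * c * \<zeta>"
  proof (cases "n = 1")
    case True
    then show ?thesis using single_block_le(2)[OF kI True i p] unfolding scale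
      by (simp add: \<zeta>_def c_def \<Omega>_def)
  next
    case False
    \<comment> \<open>balances the factor \<open>n - 1\<close> lost for the last multiplier, which is a sum of \<open>n - 1\<close> terms\<close>
    define t where "t = 1 / (real n - 1)"
    have n2: "0 < real n - 1" using False n by simp
    have t: "0 < t" "t \<le> 1" "1 + 1 / t = real n" "(1 + t) * (real n - 1) = real n"
      using n2 False n by (auto simp: t_def field_simps)
    have "w k i - ext_mult n p i = ext_mult n ((z k, w k) - p) i"
      by (simp add: ext_mult_diff ext_mult_w)
    then have "(norm (w k i - ext_mult n p i))\<^sup>2 \<le> (real n - 1) * \<Omega>"
      using norm_ext_mult_sq_le[OF i, of "(z k, w k) - p"] by (simp add: \<Omega>_def)
    then have "((1 + t) * (1 + (\<kappa> i)\<^sup>2) * (\<rho> k i)\<^sup>2) * (norm (w k i - ext_mult n p i))\<^sup>2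
        \<le> ((1 + t) * (1 + (\<kappa> i)\<^sup>2) * (\<rho> k i)\<^sup>2) * ((real n - 1) * \<Omega>)"
      using t by (intro mult_left_mono) auto
    also have "\<dots> = (1 + (\<kappa> i)\<^sup>2) * (\<rho> k i)\<^sup>2 * \<Omega> * ((1 + t) * (real n - 1))"
      by (simp only: mult_ac)
    also have "\<dots> = (\<rho> k i)\<^sup>2 * ((real n + c) * \<Omega>)"
      unfolding t(4) by (simp add: c_def algebra_simps)
    finally show ?thesis
      using dual_block_le[OF kI i p t(1,2)] unfolding scale t(3) \<zeta>_def c_def by (simp add: mult_ac)
  qed
  also have "\<dots> \<le> (\<rho> k i)\<^sup>2 * ((real n + c) * \<Omega>) + (\<rho> k i)\<^sup>2 * (2 * c / \<rho>lo\<^sup>2 * \<zeta>)"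
  proof -
    have "\<rho>lo\<^sup>2 \<le> (\<rho> k i)\<^sup>2" using r \<rho>lo(2) by (intro power_mono) auto
    then have "(2 * c / \<rho>lo\<^sup>2 * \<zeta>) * \<rho>lo\<^sup>2 \<le> (2 * c / \<rho>lo\<^sup>2 * \<zeta>) * (\<rho> k i)\<^sup>2"
      using c0 nonneg by (intro mult_left_mono) auto
    then show ?thesis using \<rho>lo(2) by (simp add: mult_ac)
  qed
  finally have "(norm (y k i - ext_mult n p i))\<^sup>2 \<le> (real n + c) * \<Omega> + 2 * c / \<rho>lo\<^sup>2 * \<zeta>"
    using r unfolding distrib_left[symmetric] by (simp add: mult_le_cancel_left_pos)
  also have "\<dots> = real n * \<Omega> + c * \<Omega> + c * (2 / (\<gamma> * \<rho>lo\<^sup>2)) * (\<gamma> * \<zeta>)"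
    using \<gamma> by (simp add: distrib_right)
  also have "\<dots> \<le> real n * dist2 p k + c * (1 + 2 / (\<gamma> * \<rho>lo\<^sup>2)) * dist2 p k"
  proof -
    define u r where "u = \<gamma> * \<zeta>" and "r = 2 / (\<gamma> * \<rho>lo\<^sup>2)"
    have "0 \<le> real n * u + c * u + c * r * \<Omega>"
      using nonneg \<gamma> c0 by (simp add: u_def r_def)
    moreover have "real n * (u + \<Omega>) + c * (1 + r) * (u + \<Omega>)
        = real n * \<Omega> + c * \<Omega> + c * r * u + (real n * u + c * u + c * r * \<Omega>)"
      by (simp add: algebra_simps)
    ultimately show ?thesis unfolding D[symmetric] u_def[symmetric] r_def[symmetric] by linarith
  qed
  also have "\<dots> \<le> real n * dist2 p k + E1 * dist2 p k"
    using kappa_E1[of i] dist2_nonneg by (intro add_left_mono mult_right_mono) (auto simp: c_def mult.assoc)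
  also have "\<dots> = (real n + E1) * dist2 p k" by (simp add: distrib_right)
  also have "\<dots> \<le> (real n + E1) * dist2 p 1"
    using dist2_antimono[OF p k] E1_nonneg by (intro mult_left_mono) auto
  finally show ?thesis .
qed

text \<open>The bound is the expression whose infimum over solutions defines the square of the
  radius \<open>Bx\<close>; \<open>y_norm_le\<close> does the same for \<open>By\<close>.\<close>

lemma x_norm_le:
  assumes k: "1 \<le> k" "enat k < K" and i: "i \<in> {1..n}" and p: "p \<in> S"
  shows "(norm (x k i))\<^sup>2
    \<le> 2 * (\<xi>1 / \<xi>2\<^sup>2 + inverse \<gamma>) * dist2 p 1 + 2 * inverse \<gamma> * (pnorm n \<gamma> p)\<^sup>2"
proof -
  have "\<gamma> * (norm (fst p))\<^sup>2 \<le> (pnorm n \<gamma> p)\<^sup>2" by (simp add: pnorm_sq[OF \<gamma>] sum_nonneg)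
  then have "(norm (fst p))\<^sup>2 \<le> inverse \<gamma> * (pnorm n \<gamma> p)\<^sup>2" using \<gamma> by (simp add: field_simps)
  moreover have "(norm (x k i))\<^sup>2 \<le> 2 * (norm (x k i - fst p))\<^sup>2 + 2 * (norm (fst p))\<^sup>2"
    using norm_add_sq_le[of 1 "x k i - fst p" "fst p"] by simp
  ultimately show ?thesis using x_dist_le[OF assms] unfolding mult.assoc by linarith
qed

lemma y_norm_le:
  assumes k: "1 \<le> k" "enat k < K" and i: "i \<in> {1..n}" and p: "p \<in> S"
  shows "(norm (y k i))\<^sup>2 \<le> 2 * (real n + E1) * dist2 p 1 + 2 * real n * (pnorm n \<gamma> p)\<^sup>2"
proof -
  have "(norm (ext_mult n p i))\<^sup>2 \<le> (real n - 1) * (\<Sum>j\<in>{1..<n}. (norm (snd p j))\<^sup>2)"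
    by (rule norm_ext_mult_sq_le[OF i])
  also have "\<dots> \<le> real n * (pnorm n \<gamma> p)\<^sup>2"
    using \<gamma> by (intro mult_mono) (auto simp: pnorm_sq[OF \<gamma>] sum_nonneg)
  finally have "(norm (ext_mult n p i))\<^sup>2 \<le> real n * (pnorm n \<gamma> p)\<^sup>2" .
  moreover have "(norm (y k i))\<^sup>2 \<le> 2 * (norm (y k i - ext_mult n p i))\<^sup>2 + 2 * (norm (ext_mult n p i))\<^sup>2"
    using norm_add_sq_le[of 1 "y k i - ext_mult n p i" "ext_mult n p i"] by simp
  ultimately show ?thesis using y_dist_le[OF assms] unfolding mult.assoc by linarith
qed

subsection \<open>Averaged iterates\<close>

lemma pnorm_nonneg' [simp]: "0 \<le> pnorm n \<gamma> (p :: 'a \<times> (nat \<Rightarrow> 'a))"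
  by (rule pnorm_nonneg[OF \<gamma>])

lemma multiplier_distance_le:
  assumes k: "1 \<le> k" "enat k < K" and p: "p \<in> S"
  shows "(\<Sum>i\<in>{1..<n}. (norm (w 1 i - w (Suc k) i))\<^sup>2) \<le> 4 * dist2 p 1"
proof -
  have "(norm (w 1 i - w (Suc k) i))\<^sup>2
      \<le> 2 * (norm (w 1 i - snd p i))\<^sup>2 + 2 * (norm (w (Suc k) i - snd p i))\<^sup>2" for i
    using norm_add_sq_le[of 1 "w 1 i - snd p i" "snd p i - w (Suc k) i"]
    by (simp add: norm_minus_commute)
  then have "(\<Sum>i\<in>{1..<n}. (norm (w 1 i - w (Suc k) i))\<^sup>2)
      \<le> (\<Sum>i\<in>{1..<n}. 2 * (norm (w 1 i - snd p i))\<^sup>2 + 2 * (norm (w (Suc k) i - snd p i))\<^sup>2)"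
    by (rule sum_mono)
  also have "\<dots> = 2 * (\<Sum>i\<in>{1..<n}. (norm (w 1 i - snd p i))\<^sup>2)
      + 2 * (\<Sum>i\<in>{1..<n}. (norm (w (Suc k) i - snd p i))\<^sup>2)"
    by (simp only: sum.distrib sum_distrib_left)
  finally show ?thesis
    using dist2_components(2)[of 1 p] dist2_components(2)[of "Suc k" p] dist2_antimono[OF p k] by linarith
qed

definition weight :: "nat \<Rightarrow> real"
  where "weight k = (\<Sum>t=1..k. \<alpha> t)"

definition average :: "nat \<Rightarrow> nat \<Rightarrow> 'a"
  where "average k i = inverse (weight k) *\<^sub>R (\<Sum>t=1..k. \<alpha> t *\<^sub>R x t i)"

lemma weight_ge:
  assumes k: "1 \<le> k" "enat k < K"
  shows "\<alpha>lo * real k \<le> weight k" "0 < weight k"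
proof -
  have "(\<Sum>t=1..k. \<alpha>lo) \<le> weight k"
    unfolding weight_def using running_antimono[OF k(2)] by (intro sum_mono alpha_ge) auto
  then show 1: "\<alpha>lo * real k \<le> weight k" by (simp add: mult.commute)
  have "0 < \<alpha>lo * real k" using alpha_lo_pos k(1) by simp
  then show "0 < weight k" using 1 by linarith
qed

lemma average_convex:
  assumes k: "1 \<le> k" "enat k < K"
  shows "average k i = (\<Sum>t=1..k. (\<alpha> t / weight k) *\<^sub>R x t i)"
    "t \<in> {1..k} \<Longrightarrow> 0 \<le> \<alpha> t / weight k"
    "(\<Sum>t=1..k. \<alpha> t / weight k) = 1"
proof -
  show "average k i = (\<Sum>t=1..k. (\<alpha> t / weight k) *\<^sub>R x t i)"
    by (simp add: average_def scaleR_sum_right divide_inverse mult.commute)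
  show "0 \<le> \<alpha> t / weight k" if "t \<in> {1..k}"
    using alpha_ge[OF running_antimono[OF k(2) that]] alpha_lo_pos weight_ge(2)[OF k] by simp
  show "(\<Sum>t=1..k. \<alpha> t / weight k) = 1"
    using weight_ge(2)[OF k] by (simp add: sum_divide_distrib[symmetric] weight_def)
qed

lemma divide_weight_le:
  assumes k: "1 \<le> k" "enat k < K" and c: "0 \<le> c"
  shows "c / weight k \<le> c / (\<alpha>lo * real k)"
  using weight_ge[OF k] alpha_lo_pos k(1) c by (intro divide_left_mono) auto

lemma average_diff_last:
  assumes k: "1 \<le> k" "enat k < K" and p: "p \<in> S" and i: "i \<in> {1..n}"
  shows "norm (average k i - average k n) \<le> 2 * pnorm n \<gamma> ((z 1, w 1) - p) / (\<alpha>lo * real k)"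
proof -
  let ?D = "pnorm n \<gamma> ((z 1, w 1) - p)"
  have D: "0 \<le> ?D" using pnorm_nonneg' .
  show ?thesis
  proof (cases "i = n")
    case True
    then show ?thesis using D alpha_lo_pos by simp
  next
    case False
    then have i: "i \<in> {1..<n}" using i by auto
    have "w 1 i - w (Suc k) i = (\<Sum>t=1..k. w t i - w (Suc t) i)"
      using sum_Suc_diff[of 1 k "\<lambda>t. - w t i"] by simp
    also have "\<dots> = (\<Sum>t=1..k. \<alpha> t *\<^sub>R (x t i - x t n))"
      using update(2)[OF running_antimono[OF k(2)] i] by (intro sum.cong) (auto simp: ps_u_def)
    finally have diff: "average k i - average k n = inverse (weight k) *\<^sub>R (w 1 i - w (Suc k) i)"
      by (simp add: average_def scaleR_diff_right sum_subtractf)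
    have "(norm (w 1 i - w (Suc k) i))\<^sup>2 \<le> (\<Sum>i\<in>{1..<n}. (norm (w 1 i - w (Suc k) i))\<^sup>2)"
      using i by (intro member_le_sum) auto
    also have "\<dots> \<le> (2 * ?D)\<^sup>2"
      using multiplier_distance_le[OF k p] by (simp add: dist2_def power_mult_distrib)
    finally have "norm (w 1 i - w (Suc k) i) \<le> 2 * ?D" using D by (auto intro: power2_le_imp_le)
    then have "norm (average k i - average k n) \<le> 2 * ?D / weight k"
      using weight_ge(2)[OF k] by (simp add: diff divide_inverse mult_left_mono mult.commute)
    also have "\<dots> \<le> 2 * ?D / (\<alpha>lo * real k)" using D by (intro divide_weight_le[OF k]) simp
    finally show ?thesis .
  qed
qed

text \<open>Passing through block \<open>n\<close> doubles the constant of
  \<open>average_diff_last\<close>.\<close>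

lemma average_diff:
  assumes k: "1 \<le> k" "enat k < K" and p: "p \<in> S" and i: "i \<in> {1..n}" "l \<in> {1..n}"
  shows "norm (average k i - average k l) \<le> 4 * pnorm n \<gamma> ((z 1, w 1) - p) / (\<alpha>lo * real k)"
proof -
  have "norm (average k i - average k l) \<le> norm (average k i - average k n) + norm (average k l - average k n)"
    using norm_triangle_ineq4[of "average k i - average k n" "average k l - average k n"] by simp
  then show ?thesis
    using average_diff_last[OF k p i(1)] average_diff_last[OF k p i(2)] by (simp add: field_simps)
qed

section \<open>Function values at the averages\<close>

lemma fin_at_x:
  assumes k: "k \<in> ps_iters K" and i: "i \<in> {1..n}"
  shows "\<bar>f i (x k i)\<bar> \<noteq> \<infinity>"
  using subgradient_finite[OF f[OF i] y_in_T[OF k i, unfolded T]] .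

lemma fin_at_solution:
  assumes p: "p \<in> S" and i: "i \<in> {1..n}"
  shows "\<bar>f i (fst p)\<bar> \<noteq> \<infinity>"
  using subgradient_finite[OF f[OF i] ext_mult_in_subdifferential[OF p[unfolded S] i, unfolded T]] .

text \<open>\<open>real_of_ereal\<close> maps both infinities to 0, so \<open>F\<close> is
  informative only where finiteness is known, as at the \<open>x k i\<close> and at
  solutions.\<close>

definition F :: "nat \<Rightarrow> 'a \<Rightarrow> real"
  where "F i u = real_of_ereal (f i u)"

lemma values_le_phi:
  assumes k: "k \<in> ps_iters K" and p: "p \<in> S"
  shows "(\<Sum>i=1..n. F i (x k i)) - (\<Sum>i=1..n. F i (fst p)) \<le> - ps_phi n (x k) (y k) (fst p, \<lambda>_. 0)"
proof -
  have "F i (x k i) - F i (fst p) \<le> - inner (fst p - x k i) (y k i)" if i: "i \<in> {1..n}" for i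
    using subgradient_ineq[OF _ fin_at_x[OF k i] fin_at_solution[OF p i], of "y k i"] y_in_T[OF k i]
    by (simp add: F_def T inner_commute)
  then have "(\<Sum>i=1..n. F i (x k i) - F i (fst p)) \<le> (\<Sum>i=1..n. - inner (fst p - x k i) (y k i))"
    by (rule sum_mono)
  then show ?thesis
    unfolding ps_phi_eq[OF n] ext_mult_zero by (simp add: sum_subtractf sum_negf)
qed

text \<open>The reference point \<open>r\<close> need not be a solution, so distances to it may
  grow. It differs from \<open>p\<close> only in the multipliers; the comparison leaves a cross
  term, bounded by Cauchy-Schwarz, which causes the part of the rate linear in the initial
  distance.\<close>

lemma dist2_drop_le:
  assumes k: "1 \<le> k" "enat k < K" and p: "p \<in> S"
  defines "r \<equiv> (fst p, \<lambda>_. 0)"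
  shows "dist2 r 1 - dist2 r (Suc k) \<le> dist2 p 1 + 4 * pnorm n \<gamma> ((z 1, w 1) - p) * pnorm n \<gamma> p"
proof -
  define c where "c = (\<Sum>i\<in>{1..<n}. inner (w 1 i - w (Suc k) i) (snd p i))"
  have sq: "(norm (u - v))\<^sup>2 = (norm u)\<^sup>2 - 2 * inner u v + (norm v)\<^sup>2" for u v :: 'a
    using norm_diff_scaleR_sq[of u 1 v] by simp
  have "dist2 r 1 - dist2 r (Suc k) = dist2 p 1 - dist2 p (Suc k) + 2 * c"
    unfolding dist2_eq r_def fst_conv snd_conv diff_zero sq c_def
    by (simp add: sum.distrib sum_subtractf sum_distrib_left inner_diff_left algebra_simps)
  moreover have "c \<le> 2 * pnorm n \<gamma> ((z 1, w 1) - p) * pnorm n \<gamma> p"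
  proof -
    let ?a = "sqrt (\<Sum>i\<in>{1..<n}. (norm (w 1 i - w (Suc k) i))\<^sup>2)"
    have "c \<le> (\<Sum>i\<in>{1..<n}. norm (w 1 i - w (Suc k) i) * norm (snd p i))"
      unfolding c_def by (intro sum_mono norm_cauchy_schwarz)
    also have "\<dots> \<le> (\<Sum>i\<in>{1..<n}. \<bar>norm (w 1 i - w (Suc k) i)\<bar> * \<bar>norm (snd p i)\<bar>)" by simp
    also have "\<dots> \<le> L2_set (\<lambda>i. norm (w 1 i - w (Suc k) i)) {1..<n} * L2_set (\<lambda>i. norm (snd p i)) {1..<n}"
      by (rule L2_set_mult_ineq)
    also have "\<dots> \<le> 2 * pnorm n \<gamma> ((z 1, w 1) - p) * pnorm n \<gamma> p"
    proof (rule mult_mono)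
      have "?a \<le> sqrt (4 * dist2 p 1)" using multiplier_distance_le[OF k p] by simp
      also have "\<dots> = 2 * pnorm n \<gamma> ((z 1, w 1) - p)"
        using pnorm_nonneg' by (simp add: dist2_def real_sqrt_mult)
      finally show "L2_set (\<lambda>i. norm (w 1 i - w (Suc k) i)) {1..<n} \<le> 2 * pnorm n \<gamma> ((z 1, w 1) - p)"
        by (simp add: L2_set_def)
      show "L2_set (\<lambda>i. norm (snd p i)) {1..<n} \<le> pnorm n \<gamma> p"
        using sqrt_sum_le_pnorm[OF \<gamma>] by (simp add: L2_set_def)
    qed (use pnorm_nonneg' in simp_all)
    finally show ?thesis .
  qed
  ultimately show ?thesis using dist2_nonneg[of p "Suc k"] by simp
qed

lemma weighted_gap_le:
  assumes k: "1 \<le> k" "enat k < K" and p: "p \<in> S"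
  shows "(\<Sum>t=1..k. \<alpha> t * ((\<Sum>i=1..n. F i (x t i)) - (\<Sum>i=1..n. F i (fst p))))
    \<le> dist2 p 1 / 2 + 2 * pnorm n \<gamma> ((z 1, w 1) - p) * pnorm n \<gamma> p"
proof -
  define r where "r = (fst p, \<lambda>_::nat. 0 :: 'a)"
  have "2 * (\<alpha> t * ((\<Sum>i=1..n. F i (x t i)) - (\<Sum>i=1..n. F i (fst p)))) \<le> dist2 r t - dist2 r (Suc t)"
    if t: "t \<in> {1..k}" for t
  proof -
    note t' = running_antimono[OF k(2) t]
    have "\<alpha> t * ((\<Sum>i=1..n. F i (x t i)) - (\<Sum>i=1..n. F i (fst p)))
        \<le> \<alpha> t * - ps_phi n (x t) (y t) r"
      unfolding r_def using values_le_phi[OF running(1)[OF t'] p] alpha_ge[OF t'] alpha_lo_pos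
      by (intro mult_left_mono) auto
    then show ?thesis using dist2_step[OF t', of r] by simp
  qed
  then have "(\<Sum>t=1..k. 2 * (\<alpha> t * ((\<Sum>i=1..n. F i (x t i)) - (\<Sum>i=1..n. F i (fst p)))))
      \<le> (\<Sum>t=1..k. dist2 r t - dist2 r (Suc t))"
    by (rule sum_mono)
  also have "\<dots> = dist2 r 1 - dist2 r (Suc k)"
    using sum_Suc_diff[of 1 k "\<lambda>t. - dist2 r t"] by simp
  also have "\<dots> \<le> dist2 p 1 + 4 * pnorm n \<gamma> ((z 1, w 1) - p) * pnorm n \<gamma> p"
    unfolding r_def by (rule dist2_drop_le[OF k p])
  finally show ?thesis by (simp add: sum_distrib_left[symmetric])
qed

lemma average_value_le:
  assumes k: "1 \<le> k" "enat k < K" and p: "p \<in> S"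
  shows "(\<Sum>i=1..n. f i (average k i)) \<le> ereal ((\<Sum>i=1..n. F i (fst p))
    + (dist2 p 1 / 2 + 2 * pnorm n \<gamma> ((z 1, w 1) - p) * pnorm n \<gamma> p) / (\<alpha>lo * real k))"
proof -
  let ?c = "\<lambda>t. \<alpha> t / weight k" and ?B = "dist2 p 1 / 2 + 2 * pnorm n \<gamma> ((z 1, w 1) - p) * pnorm n \<gamma> p"
  have "f i (average k i) \<le> ereal (\<Sum>t=1..k. ?c t * F i (x t i))" if i: "i \<in> {1..n}" for i
    unfolding average_convex(1)[OF k] F_def
    using average_convex(2,3)[OF k] fin_at_x[OF running(1)[OF running_antimono[OF k(2)]] i]
    by (intro convex_closed_proper_Jensen[OF f[OF i]]) auto
  then have "(\<Sum>i=1..n. f i (average k i)) \<le> (\<Sum>i=1..n. ereal (\<Sum>t=1..k. ?c t * F i (x t i)))"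
    by (rule sum_mono)
  also have "\<dots> = ereal (\<Sum>i=1..n. \<Sum>t=1..k. ?c t * F i (x t i))" by simp
  also have "(\<Sum>i=1..n. \<Sum>t=1..k. ?c t * F i (x t i)) = (\<Sum>t=1..k. ?c t * (\<Sum>i=1..n. F i (x t i)))"
    unfolding sum_distrib_left by (rule sum.swap)
  \<comment> \<open>The weights sum to 1, so the optimal value splits off and the weighted gaps
    remain.\<close>
  also have "\<dots> = (\<Sum>t=1..k. ?c t) * (\<Sum>i=1..n. F i (fst p))
      + (\<Sum>t=1..k. \<alpha> t * ((\<Sum>i=1..n. F i (x t i)) - (\<Sum>i=1..n. F i (fst p)))) / weight k"
    by (simp add: sum_distrib_right sum_divide_distrib sum.distrib[symmetric] right_diff_distrib diff_divide_distrib)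
  also have "\<dots> \<le> 1 * (\<Sum>i=1..n. F i (fst p)) + ?B / weight k"
    using weighted_gap_le[OF k p] weight_ge(2)[OF k] unfolding average_convex(3)[OF k]
    by (intro add_left_mono divide_right_mono) auto
  also have "\<dots> \<le> (\<Sum>i=1..n. F i (fst p)) + ?B / (\<alpha>lo * real k)"
    unfolding mult_1 using dist2_nonneg pnorm_nonneg'
    by (intro add_left_mono divide_weight_le[OF k]) simp
  finally show ?thesis by simp
qed

lemma sum_f_solution: "p \<in> S \<Longrightarrow> (\<Sum>i=1..n. f i (fst p)) = ereal (\<Sum>i=1..n. F i (fst p))"
  using fin_at_solution by (simp add: F_def ereal_real' flip: sum_ereal)

lemma T_eq: "T = (\<lambda>i. subdifferential (f i))"
  by (rule ext) (rule T)

lemma minimum_eq: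
  assumes p: "p \<in> S"
  shows "(INF u. \<Sum>i=1..n. f i u) = ereal (\<Sum>i=1..n. F i (fst p))"
proof -
  have "(fst p, snd p) \<in> extended_solutions n (\<lambda>i. subdifferential (f i))"
    using p unfolding S T_eq by simp
  from minimum_attained[OF n this] sum_f_solution[OF p] show ?thesis by (simp only:)
qed

section \<open>Passing to a common argument\<close>

lemma average_in_cball:
  assumes k: "1 \<le> k" "enat k < K" and R: "\<And>t. t \<in> {1..k} \<Longrightarrow> norm (x t i) \<le> R"
  shows "average k i \<in> cball 0 R"
  unfolding average_convex(1)[OF k]
  using average_convex(2,3)[OF k] R by (intro convex_sum) auto

text \<open>Block \<open>j\<close> keeps its argument, the other backward blocks pay their Lipschitz
  constant and the forward blocks the size of a gradient, each times the distance between the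
  averages.\<close>

lemma average_common_le:
  assumes k: "1 \<le> k" "enat k < K" and p: "p \<in> S" and j: "j \<in> {1..n}"
    and Bx: "\<And>t i. t \<in> {1..k} \<Longrightarrow> i \<in> {1..n} \<Longrightarrow> norm (x t i) \<le> Bx"
    and By: "\<And>t i. t \<in> {1..k} \<Longrightarrow> i \<in> {1..n} \<Longrightarrow> norm (y t i) \<le> By"
    and ILip: "ILip \<subseteq> IB" "IB - ILip \<subseteq> {j}"
    and fin: "\<And>i u. i \<in> ILip \<Longrightarrow> u \<in> cball 0 Bx \<Longrightarrow> \<bar>f i u\<bar> \<noteq> \<infinity>"
    and Lip: "\<And>i. i \<in> ILip \<Longrightarrow> (M i)-lipschitz_on (cball 0 Bx) (F i)"
  shows "(\<Sum>i=1..n. f i (average k j)) \<le> (\<Sum>i=1..n. f i (average k i))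
    + ereal (((\<Sum>i\<in>ILip. M i) + real n * (By + 2 * Lbar * Bx))
        * (4 * pnorm n \<gamma> ((z 1, w 1) - p) / (\<alpha>lo * real k)))"
proof -
  define \<Delta> where "\<Delta> = 4 * pnorm n \<gamma> ((z 1, w 1) - p) / (\<alpha>lo * real k)"
  define C where "C = By + 2 * Lbar * Bx"
  have \<Delta>: "0 \<le> \<Delta>" using pnorm_nonneg' alpha_lo_pos by (simp add: \<Delta>_def)
  have diff: "norm (average k i - average k l) \<le> \<Delta>" if "i \<in> {1..n}" "l \<in> {1..n}" for i l
    unfolding \<Delta>_def by (rule average_diff[OF k p that])
  have ball: "average k i \<in> cball 0 Bx" if "i \<in> {1..n}" for i
    using Bx that by (intro average_in_cball[OF k]) auto
  have one: "1 \<in> {1..k}" using k(1) by simp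
  have By0: "0 \<le> By" using By[OF one j] norm_ge_zero order_trans by blast
  have Bx0: "0 \<le> Bx" using Bx[OF one j] norm_ge_zero order_trans by blast
  have C0: "0 \<le> C" using By0 Bx0 Lbar_nonneg by (simp add: C_def)
  have M0: "0 \<le> M i" if "i \<in> ILip" for i using Lip[OF that] lipschitz_on_nonneg by blast
  \<comment> \<open>Charging \<open>C * \<Delta>\<close> to every block gives the factor
    \<open>n\<close> of the claim.\<close>
  define b where "b i = (if i \<in> ILip then M i else 0) * \<Delta> + C * \<Delta>" for i
  have b0: "0 \<le> b i" for i using M0 C0 \<Delta> by (simp add: b_def)
  have "f i (average k j) \<le> f i (average k i) + ereal (b i)" if i: "i \<in> {1..n}" for i
  proof -
    have "i \<in> IF \<union> IB" using i partition(1) by simp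
    then consider "i = j" | "i \<in> ILip" | "i \<in> IF" using ILip by blast
    then show ?thesis
    proof cases
      case 1
      then show ?thesis using b0[of i] add_left_mono[of 0 "ereal (b i)" "f i (average k i)"] by simp
    next
      case 2
      have "dist (F i (average k j)) (F i (average k i)) \<le> M i * dist (average k j) (average k i)"
        by (rule lipschitz_onD[OF Lip[OF 2] ball[OF j] ball[OF i]])
      also have "\<dots> \<le> M i * \<Delta>" using M0[OF 2] diff[OF j i] by (simp add: dist_norm mult_left_mono)
      also have "\<dots> \<le> b i" using 2 C0 \<Delta> by (simp add: b_def)
      finally have "F i (average k j) \<le> F i (average k i) + b i" by (simp add: dist_real_def)
      then show ?thesis
        using fin[OF 2 ball[OF j]] fin[OF 2 ball[OF i]] unfolding F_def
        by (cases "f i (average k j)"; cases "f i (average k i)") auto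
    next
      case 3
      \<comment> \<open>The comparison point \<open>x 1 i\<close> has gradient \<open>y 1 i\<close>,
        which \<open>By\<close> bounds; both points lie in the ball of radius
        \<open>Bx\<close>.\<close>
      have "norm (g i (average k j)) \<le> norm (g i (x 1 i)) + norm (g i (average k j) - g i (x 1 i))"
        by (rule norm_triangle_sub)
      also have "norm (g i (x 1 i)) \<le> By"
        using By[OF one i] forward_update(2)[OF one_in_iters 3] by simp
      also have "norm (g i (average k j) - g i (x 1 i)) \<le> Lbar * (2 * Bx)"
      proof -
        have "norm (average k j - x 1 i) \<le> 2 * Bx"
          using norm_triangle_ineq4[of "average k j" "x 1 i"] ball[OF j] Bx[OF one i] by simp
        then have "L i * norm (average k j - x 1 i) \<le> Lbar * (2 * Bx)"
          using L_le_Lbar[OF 3] Lbar_nonneg by (intro mult_mono) auto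
        then show ?thesis using g_lipschitz[OF 3] order_trans by blast
      qed
      finally have "norm (g i (average k j)) \<le> C" by (simp add: C_def)
      then have "norm (g i (average k j)) * norm (average k j - average k i) \<le> C * \<Delta>"
        using C0 diff[OF j i] by (intro mult_mono) auto
      then have "inner (g i (average k j)) (average k j - average k i) \<le> C * \<Delta>"
        using norm_cauchy_schwarz order_trans by blast
      also have "\<dots> \<le> b i" using M0 \<Delta> by (simp add: b_def)
      finally have "F i (average k j) \<le> F i (average k i) + b i"
        using subgradient_ineq[OF g_in_T[OF 3, of "average k j", unfolded T] f_finite[OF 3] f_finite[OF 3], of "average k i"]
        by (simp add: F_def inner_diff)
      then show ?thesis
        using f_finite[OF 3, of "average k j"] f_finite[OF 3, of "average k i"] unfolding F_def
        by (cases "f i (average k j)"; cases "f i (average k i)") auto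
    qed
  qed
  then have "(\<Sum>i=1..n. f i (average k j)) \<le> (\<Sum>i=1..n. f i (average k i) + ereal (b i))"
    by (rule sum_mono)
  also have "\<dots> = (\<Sum>i=1..n. f i (average k i)) + ereal (\<Sum>i=1..n. b i)"
    by (simp add: sum.distrib)
  also have "(\<Sum>i=1..n. b i) = ((\<Sum>i\<in>ILip. M i) + real n * C) * \<Delta>"
  proof -
    have "ILip \<subseteq> {1..n}" using ILip(1) index by auto
    then have "(\<Sum>i=1..n. if i \<in> ILip then M i else 0) = (\<Sum>i\<in>ILip. M i)"
      by (simp add: sum.inter_restrict[symmetric] Int_absorb1 del: One_nat_def)
    then show ?thesis
      unfolding b_def sum.distrib sum_distrib_right[symmetric] by (simp add: distrib_right)
  qed
  finally show ?thesis by (simp add: \<Delta>_def C_def)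
qed

text \<open>A vanishing \<open>ps_pi\<close> makes all \<open>x k i\<close> coincide and the
  \<open>y k i\<close> sum to zero, so the common point with these subgradients is itself an
  extended solution.\<close>

lemma optimal_at_stop:
  assumes K: "K = enat k" and j: "j \<in> {1..n}"
  shows "x k j = z (Suc k)" "(\<Sum>i=1..n. f i (z (Suc k))) = (INF u. \<Sum>i=1..n. f i u)"
proof -
  note k = pi_at_stop[OF K]
  have z: "z (Suc k) = x k n" using step[OF k(1)] k(2) by (simp add: ps_step_def)
  have u0: "(\<Sum>i\<in>{1..<n}. (norm (ps_u n (x k) i))\<^sup>2) = 0" and v0: "inverse \<gamma> * (norm (ps_v n (y k)))\<^sup>2 = 0"
    using k(2) \<gamma> unfolding ps_pi_def
    by (smt (verit) inverse_positive_iff_positive mult_nonneg_nonneg sum_nonneg zero_le_power2)+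
  have "ps_u n (x k) i = 0" if "i \<in> {1..<n}" for i
    using u0 that by (simp add: sum_nonneg_eq_0_iff)
  then have x: "x k i = x k n" if "i \<in> {1..n}" for i
    using that by (cases "i = n") (auto simp: ps_u_def)
  from x[OF j] show "x k j = z (Suc k)" unfolding z .
  have "(\<Sum>i=1..n. y k i) = 0" using v0 \<gamma> by (simp add: ps_v_def)
  then have "y k n = - (\<Sum>i\<in>{1..<n}. y k i)"
    unfolding sum_upto_split_last[OF n] by (simp add: eq_neg_iff_add_eq_0 add.commute)
  moreover have "y k i \<in> T i (x k n)" if "i \<in> {1..n}" for i
    using y_in_T[OF k(1) that] x[OF that] by simp
  ultimately have "(x k n, y k) \<in> extended_solutions n T"
    using n by (auto simp: extended_solutions_def) (metis atLeastAtMost_iff le_refl One_nat_def)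
  then show "(\<Sum>i=1..n. f i (z (Suc k))) = (INF u. \<Sum>i=1..n. f i u)"
    using minimum_attained[OF n] unfolding z T_eq by blast
qed

end


section \<open>The convergence rates\<close>

theorem theorem1:
  fixes n :: nat and IF IB :: "nat set"
    and f :: "nat \<Rightarrow> 'a::{real_inner, complete_space} \<Rightarrow> ereal"
    and g :: "nat \<Rightarrow> 'a \<Rightarrow> 'a" and L :: "nat \<Rightarrow> real"
    and T :: "nat \<Rightarrow> 'a \<Rightarrow> 'a set" and S :: "('a \<times> (nat \<Rightarrow> 'a)) set" and Fstar :: ereal
    and \<gamma> :: real and \<rho> :: "nat \<Rightarrow> nat \<Rightarrow> real" and \<beta> :: "nat \<Rightarrow> real"
    and e x y w :: "nat \<Rightarrow> nat \<Rightarrow> 'a" and z :: "nat \<Rightarrow> 'a"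
    and K :: enat
    and \<beta>lo \<beta>hi \<sigma> \<delta> \<rho>lo \<rho>hi Lbar \<tau> \<xi>1 \<xi>2 \<alpha>lo E1 E2 E3 Bx By :: real
    and \<rho>up :: "nat \<Rightarrow> real"
    and \<alpha> :: "nat \<Rightarrow> real" and xbar :: "nat \<Rightarrow> nat \<Rightarrow> 'a"
    and p1 pstar :: "'a \<times> (nat \<Rightarrow> 'a)"
  \<comment> \<open>problem\<close>
  assumes n: "n \<ge> 1"
    and partition: "IF \<union> IB = {1..n}" "IF \<inter> IB = {}"
    and f: "\<And>i. i \<in> {1..n} \<Longrightarrow> convex_closed_proper (f i)"
    and f_finite: "\<And>i u. i \<in> IF \<Longrightarrow> \<bar>f i u\<bar> \<noteq> \<infinity>"
    and f_grad: "\<And>i u. i \<in> IF \<Longrightarrow> GDERIV (\<lambda>v. real_of_ereal (f i v)) u :> g i u"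
    and f_lip: "\<And>i. i \<in> IF \<Longrightarrow> (L i)-lipschitz_on UNIV (g i)"
    and T: "\<And>i. T i = subdifferential (f i)"
    and S: "S = extended_solutions n T" "S \<noteq> {}"
    and Fstar: "Fstar = (INF u. \<Sum>i=1..n. f i u)"
  \<comment> \<open>algorithm\<close>
    and \<gamma>: "\<gamma> > 0"
    and run: "projective_splitting n IF IB T g \<gamma> \<rho> \<beta> e z w x y"
    and K: "K = ps_stop n \<gamma> x y"
    and \<beta>: "0 < \<beta>lo" "\<beta>lo \<le> \<beta>hi" "\<beta>hi < 2"
      "\<And>k. k \<in> ps_iters K \<Longrightarrow> \<beta> k \<in> {\<beta>lo..\<beta>hi}"
    and \<alpha>: "\<And>k. \<alpha> k = ps_alpha n \<gamma> (\<beta> k) (z k, w k) (x k) (y k)"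
    and p1: "p1 = (z 1, w 1)"
  \<comment> \<open>error conditions\<close>
    and \<sigma>: "0 \<le> \<sigma>" "\<sigma> < 1" and \<delta>: "0 \<le> \<delta>"
    and err1: "\<And>k i. k \<in> ps_iters K \<Longrightarrow> i \<in> IB \<Longrightarrow>
      inner (z k - x k i) (e k i) \<ge> - \<sigma> * (norm (z k - x k i))\<^sup>2"
    and err2: "\<And>k i. k \<in> ps_iters K \<Longrightarrow> i \<in> IB \<Longrightarrow>
      inner (e k i) (y k i - w k i) \<le> \<rho> k i * \<sigma> * (norm (y k i - w k i))\<^sup>2"
    and err3: "\<And>k i. k \<in> ps_iters K \<Longrightarrow> i \<in> IB \<Longrightarrow>
      (norm (e k i))\<^sup>2 \<le> \<delta> * (norm (z k - x k i))\<^sup>2"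
  \<comment> \<open>stepsize conditions\<close>
    and \<rho>_pos: "\<And>k i. k \<in> ps_iters K \<Longrightarrow> i \<in> {1..n} \<Longrightarrow> \<rho> k i > 0"
    and \<rho>lo: "\<rho>lo = Min ((\<lambda>i. INF k\<in>ps_iters K. \<rho> k i) ` {1..n})" "\<rho>lo > 0"
    and \<rho>up: "\<And>i. \<rho>up i = (SUP k\<in>ps_iters K. \<rho> k i)"
      "\<And>i. i \<in> {1..n} \<Longrightarrow> bdd_above ((\<lambda>k. \<rho> k i) ` ps_iters K)"
      \<comment> \<open>division in \<^typ>\<open>ereal\<close>: the bound is \<open>\<infinity>\<close> if \<open>L i = 0\<close>\<close>
      "\<And>i. i \<in> IF \<Longrightarrow> ereal (\<rho>up i) < 1 / ereal (L i)"
  \<comment> \<open>constants\<close>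
    and \<rho>hi: "\<rho>hi = (if IB = {} then 0 else Max (\<rho>up ` IB))"
    and Lbar: "Lbar = (if IF = {} then 0 else Max (L ` IF))"
    and \<tau>: "\<tau> = inverse \<beta>lo * inverse (2 - \<beta>hi)"
    and \<xi>1: "\<xi>1 = 2 * real n *
      (1 + 2 * inverse \<gamma> * (Lbar\<^sup>2 * real (card IF) + inverse (\<rho>lo\<^sup>2) * (1 + \<delta>)))"
    and \<xi>2: "\<xi>2 = Min ((if IB = {} then {} else {(1 - \<sigma>) * inverse \<rho>hi})
      \<union> (\<lambda>j. inverse (\<rho>up j) - L j) ` IF)"
    and \<alpha>lo: "\<alpha>lo = \<beta>lo * \<xi>2 / \<xi>1"
    and E1: "E1 = 2 * inverse (1 - \<sigma>) * inverse \<rho>lo *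
      (1 + inverse \<xi>2 * Lbar * (1 + \<rho>lo * Lbar)) * (\<xi>1 / (\<beta>lo\<^sup>2 * \<xi>2))"
      \<comment> \<open>the minima over \<open>S\<close> are written as infima, which have the same values\<close>
    and Bx: "Bx \<ge> 0" "Bx\<^sup>2 = (INF p\<in>S.
      2 * (\<xi>1 / \<xi>2\<^sup>2 + inverse \<gamma>) * (pnorm n \<gamma> (p1 - p))\<^sup>2 + 2 * inverse \<gamma> * (pnorm n \<gamma> p)\<^sup>2)"
    and By: "By \<ge> 0" "By\<^sup>2 = (INF p\<in>S.
      2 * (real n + E1) * (pnorm n \<gamma> (p1 - p))\<^sup>2 + 2 * real n * (pnorm n \<gamma> p)\<^sup>2)"
  \<comment> \<open>averaged iterates and rate constants\<close>
    and xbar: "\<And>k i. xbar k i = inverse (\<Sum>t=1..k. \<alpha> t) *\<^sub>R (\<Sum>t=1..k. \<alpha> t *\<^sub>R x t i)"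
    and pstar: "pstar \<in> S"
    and E2: "E2 = \<xi>1 / (2 * \<beta>lo * \<xi>2) * (1 + (3 + 2 * E1) * \<tau>
      + \<rho>up n * \<tau> * (2 + \<gamma> * E1 + \<gamma> * \<delta> * \<xi>1 / (\<beta>lo\<^sup>2 * \<xi>2\<^sup>2)))"
    and E3: "E3 = 2 * sqrt (real n) * pnorm n \<gamma> pstar * (\<xi>1 / (\<beta>lo * \<xi>2))"
  shows
    "(\<forall>k j. K = enat k \<longrightarrow> j \<in> {1..n} \<longrightarrow>
       (\<Sum>i=1..n. f i (x k j)) = (\<Sum>i=1..n. f i (z (Suc k))) \<and>
       (\<Sum>i=1..n. f i (z (Suc k))) = Fstar) \<and>
     (\<forall>k. 1 \<le> k \<longrightarrow> enat k < K \<longrightarrow>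
       (\<Sum>i=1..n. f i (xbar k i)) - Fstar
         \<le> ereal ((E2 * (pnorm n \<gamma> (p1 - pstar))\<^sup>2 + E3 * pnorm n \<gamma> (p1 - pstar)) / real k) \<and>
       (\<forall>i\<in>{1..n}. \<forall>l\<in>{1..n}.
         norm (xbar k i - xbar k l) \<le> 4 * pnorm n \<gamma> (p1 - pstar) / (\<alpha>lo * real k) \<and>
         4 * pnorm n \<gamma> (p1 - pstar) / (\<alpha>lo * real k)
           = 4 * \<xi>1 * pnorm n \<gamma> (p1 - pstar) / (\<beta>lo * \<xi>2 * real k))) \<and>
     (\<forall>ILip M j E4.
       (if card IB > 1
        then ILip \<subseteq> IB \<and> card ILip = card IB - 1 \<and>
          (\<forall>i\<in>ILip. (\<forall>u\<in>cball 0 Bx. \<bar>f i u\<bar> \<noteq> \<infinity>) \<and>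
             (M i)-lipschitz_on (cball 0 Bx) (\<lambda>u. real_of_ereal (f i u)))
        else ILip = {}) \<longrightarrow>
       (if card IB = 0 then j \<in> IF else if card IB = 1 then j \<in> IB else j \<in> IB - ILip) \<longrightarrow>
       E4 = E3 + 4 * \<xi>1 / (\<beta>lo * \<xi>2)
         * ((\<Sum>i\<in>ILip. M i) + real n * (By + 2 * Lbar * Bx)) \<longrightarrow>
       (\<forall>k. 1 \<le> k \<longrightarrow> enat k < K \<longrightarrow>
         (\<Sum>i=1..n. f i (xbar k j)) - Fstar
           \<le> ereal ((E2 * (pnorm n \<gamma> (p1 - pstar))\<^sup>2 + E4 * pnorm n \<gamma> (p1 - pstar)) / real k)))"
proof -
  interpret R: projective_splitting_run n IF IB f g L T S \<gamma> \<rho> \<beta> e x y w z K \<beta>lo \<beta>hi \<sigma> \<delta>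
      \<rho>lo \<rho>hi Lbar \<xi>1 \<xi>2 \<alpha>lo E1 \<rho>up \<alpha>
    by (rule projective_splitting_run.intro)
      (fact n partition f f_finite f_grad f_lip T S(1) \<gamma> run K \<beta> \<alpha> \<sigma> \<delta> err1 err2 err3
        \<rho>_pos \<rho>lo \<rho>up \<rho>hi Lbar \<xi>1 \<xi>2 \<alpha>lo E1)+
  define D P Q Fs where "D = pnorm n \<gamma> (p1 - pstar)" and "P = pnorm n \<gamma> pstar"
    and "Q = \<xi>1 / (\<beta>lo * \<xi>2)" and "Fs = (\<Sum>i=1..n. R.F i (fst pstar))"
  have xbar: "xbar k i = R.average k i" for k i
    by (simp add: xbar R.average_def R.weight_def)
  have Fstar_eq: "Fstar = ereal Fs"
    unfolding Fstar Fs_def by (rule R.minimum_eq[OF pstar])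
  have D: "0 \<le> D" and P: "0 \<le> P" by (simp_all add: D_def P_def)
  have Q: "0 < Q" using R.xi1_pos R.xi2_props(1) \<beta>(1) by (simp add: Q_def)
  have alpha_lo: "a / (\<alpha>lo * real k) = Q * a / real k" for a k
    by (simp add: \<alpha>lo Q_def)
  \<comment> \<open>The leading summand is a lower bound, as the other summands are nonnegative;
    this and the next bound fit \<open>E2\<close> and \<open>E3\<close> to
    \<open>average_value_le\<close>.\<close>
  have E2: "Q / 2 \<le> E2"
  proof -
    have "0 \<le> \<rho>up n" using R.rho_bounds(4)[OF R.one_in_iters, of n] n by simp
    moreover have "0 \<le> \<tau>" using \<beta> by (simp add: \<tau>)
    ultimately have "0 \<le> (3 + 2 * E1) * \<tau>"
      "0 \<le> \<rho>up n * \<tau> * (2 + \<gamma> * E1 + \<gamma> * \<delta> * \<xi>1 / (\<beta>lo\<^sup>2 * \<xi>2\<^sup>2))"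
      using R.E1_nonneg R.xi1_pos \<gamma> \<delta> by (auto intro!: mult_nonneg_nonneg add_nonneg_nonneg)
    then have "Q / 2 * 1 \<le> Q / 2 * (1 + (3 + 2 * E1) * \<tau>
        + \<rho>up n * \<tau> * (2 + \<gamma> * E1 + \<gamma> * \<delta> * \<xi>1 / (\<beta>lo\<^sup>2 * \<xi>2\<^sup>2)))"
      using Q by (intro mult_left_mono) auto
    then show ?thesis by (simp add: E2 Q_def mult_ac)
  qed
  have E3: "2 * P * Q \<le> E3"
  proof -
    have "2 * P * Q * 1 \<le> 2 * P * Q * sqrt (real n)" using P Q n by (intro mult_left_mono) auto
    then show ?thesis by (simp add: E3 P_def Q_def mult_ac)
  qed
  have rate: "(\<Sum>i=1..n. f i (xbar k i)) \<le> ereal (Fs + (E2 * D\<^sup>2 + E3 * D) / real k)"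
    if k: "1 \<le> k" "enat k < K" for k
  proof -
    have "Q * (D\<^sup>2 / 2 + 2 * D * P) = Q / 2 * D\<^sup>2 + 2 * P * Q * D" by (simp add: algebra_simps)
    also have "\<dots> \<le> E2 * D\<^sup>2 + E3 * D" using E2 E3 D by (intro add_mono mult_right_mono) auto
    finally have "Q * (D\<^sup>2 / 2 + 2 * D * P) / real k \<le> (E2 * D\<^sup>2 + E3 * D) / real k"
      by (rule divide_right_mono) simp
    moreover have "(\<Sum>i=1..n. f i (xbar k i)) \<le> ereal (Fs + Q * (D\<^sup>2 / 2 + 2 * D * P) / real k)"
      using R.average_value_le[OF k pstar] unfolding xbar alpha_lo R.dist2_def
      by (simp only: D_def P_def Fs_def p1)
    ultimately show ?thesis by (meson add_left_mono ereal_less_eq(3) order_trans)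
  qed
  \<comment> \<open>Finiteness of \<open>Fstar\<close> makes the subtraction of extended reals
    harmless.\<close>
  have sub: "a - Fstar \<le> ereal b" if "a \<le> ereal (Fs + b)" for a b
    using that unfolding Fstar_eq by (cases a) auto
  have part1: "(\<Sum>i=1..n. f i (x k j)) = (\<Sum>i=1..n. f i (z (Suc k)))"
    "(\<Sum>i=1..n. f i (z (Suc k))) = Fstar" if "K = enat k" "j \<in> {1..n}" for k j
    using R.optimal_at_stop[OF that] by (simp_all add: Fstar)
  have part2: "norm (xbar k i - xbar k l) \<le> 4 * D / (\<alpha>lo * real k)"
    if "1 \<le> k" "enat k < K" "i \<in> {1..n}" "l \<in> {1..n}" for k i l
    using R.average_diff[OF that(1,2) pstar that(3,4)] unfolding xbar D_def p1 .
  have part2': "4 * D / (\<alpha>lo * real k) = 4 * \<xi>1 * D / (\<beta>lo * \<xi>2 * real k)" for k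
    by (simp add: alpha_lo Q_def)
  \<comment> \<open>The estimate holds for every solution, so it lies below the infimum that defines
    \<open>Bx\<^sup>2\<close>.\<close>
  have x_bound: "norm (x t i) \<le> Bx" if "t \<in> {1..k}" "enat k < K" "i \<in> {1..n}" for t i k
  proof (rule power2_le_imp_le[OF _ Bx(1)])
    note t = R.running_antimono[OF that(2,1)]
    show "(norm (x t i))\<^sup>2 \<le> Bx\<^sup>2"
      unfolding Bx(2) p1
      by (rule cINF_greatest[OF S(2)]) (rule R.x_norm_le[OF t that(3), unfolded R.dist2_def])
  qed
  have y_bound: "norm (y t i) \<le> By" if "t \<in> {1..k}" "enat k < K" "i \<in> {1..n}" for t i k
  proof (rule power2_le_imp_le[OF _ By(1)])
    note t = R.running_antimono[OF that(2,1)]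
    show "(norm (y t i))\<^sup>2 \<le> By\<^sup>2"
      unfolding By(2) p1
      by (rule cINF_greatest[OF S(2)]) (rule R.y_norm_le[OF t that(3), unfolded R.dist2_def])
  qed
  have part3: "(\<Sum>i=1..n. f i (xbar k j)) - Fstar \<le> ereal ((E2 * D\<^sup>2 + E4 * D) / real k)"
    if Lip: "if card IB > 1
        then ILip \<subseteq> IB \<and> card ILip = card IB - 1 \<and>
          (\<forall>i\<in>ILip. (\<forall>u\<in>cball 0 Bx. \<bar>f i u\<bar> \<noteq> \<infinity>) \<and>
             (M i)-lipschitz_on (cball 0 Bx) (\<lambda>u. real_of_ereal (f i u)))
        else ILip = {}"
      and j: "if card IB = 0 then j \<in> IF else if card IB = 1 then j \<in> IB else j \<in> IB - ILip"
      and E4: "E4 = E3 + 4 * \<xi>1 / (\<beta>lo * \<xi>2)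
         * ((\<Sum>i\<in>ILip. M i) + real n * (By + 2 * Lbar * Bx))"
      and k: "1 \<le> k" "enat k < K"
    for ILip M j E4 k
  proof -
    define C where "C = (\<Sum>i\<in>ILip. M i) + real n * (By + 2 * Lbar * Bx)"
    have E4': "E4 = E3 + 4 * Q * C" by (simp add: E4 C_def Q_def)
    have j_index: "j \<in> {1..n}" using j R.index by (auto split: if_splits)
    have ILip: "ILip \<subseteq> IB" using Lip by (auto split: if_splits)
    \<comment> \<open>If \<open>IB\<close> is nonempty, \<open>j\<close> is the one backward block
      left over; otherwise the difference is empty and \<open>j\<close> is a forward block.\<close>
    have "IB - ILip \<subseteq> {j}"
    proof (cases "card IB > 1")
      case True
      then have "card (IB - ILip) = 1"
        using Lip card_Diff_subset[OF finite_subset[OF ILip R.finite_IB] ILip] by simp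
      then obtain a where "IB - ILip = {a}" by (rule card_1_singletonE)
      moreover have "j \<in> IB - ILip" using j True by simp
      ultimately show ?thesis by simp
    next
      case False
      show ?thesis
      proof (cases "card IB = 0")
        case True
        then show ?thesis using R.finite_IB by simp
      next
        case nonempty: False
        then have one: "card IB = 1" using False by simp
        then obtain a where "IB = {a}" by (rule card_1_singletonE)
        then show ?thesis using j one by simp
      qed
    qed
    moreover have "R.F i = (\<lambda>u. real_of_ereal (f i u))" for i by (simp add: R.F_def fun_eq_iff)
    ultimately have "(\<Sum>i=1..n. f i (R.average k j)) \<le> (\<Sum>i=1..n. f i (R.average k i))
        + ereal (C * (4 * pnorm n \<gamma> ((z 1, w 1) - pstar) / (\<alpha>lo * real k)))"
      unfolding C_def using Lip
      by (intro R.average_common_le[OF k pstar j_index x_bound y_bound ILip]) (auto simp: k split: if_splits)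
    then have "(\<Sum>i=1..n. f i (xbar k j)) \<le> (\<Sum>i=1..n. f i (xbar k i)) + ereal (Q * (4 * D) / real k * C)"
      unfolding alpha_lo xbar by (simp only: D_def p1 mult.commute)
    also have "\<dots> \<le> ereal (Fs + (E2 * D\<^sup>2 + E3 * D) / real k) + ereal (Q * (4 * D) / real k * C)"
      by (rule add_right_mono[OF rate[OF k]])
    also have "\<dots> = ereal (Fs + (E2 * D\<^sup>2 + E4 * D) / real k)"
      unfolding E4' plus_ereal.simps by (simp add: add_divide_distrib algebra_simps)
    finally show ?thesis by (rule sub)
  qed
  show ?thesis
    using part1 part2 part2' part3 sub[OF rate] unfolding D_def by blast
qed

end
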